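(* Let $k_1,k_2\ge0$. The algebra $\mathcal{D}(\mathcal{W}_k)$ is generated by the identity $I_2$, $S=\begin{pmatrix}0&1\\ 1&0\end{pmatrix}$, and $\mathcal{D}_k$. Moreover, for every $N\ge0$ the quotient $\mathcal{D}(\mathcal{W}_k)^{(N)}/\mathcal{D}(\mathcal{W}_k)^{(N-1)}$ is a two-dimensional complex vector space.
   Context: For $k=(k_1,k_2)$ let $\rho(k)=\frac12(k_1+2k_2)$, $w_k(x)=2^{k_1+2k_2}(1-x)^{k_1+k_2-\frac12}(1+x)^{k_2-\frac12}$ and $$\mathcal{W}_k(x)=\begin{pmatrix}1 & x \\ x & 1\end{pmatrix}w_k(x)\quad\text{on }(-1,1).$$ Let $\mathbb{M}_2$ be the complex $2\times2$ matrices and $\mathbb{A}_2=\mathbb{C}[x,\partial_x]\otimes\mathbb{M}_2$ the matrix Weyl algebra, acting on $\mathbb{M}_2[x]=\mathbb{C}[x]\otimes\mathbb{M}_2$ from the left. A family of matrix-valued orthogonal polynomials for $\mathcal{W}_k$ is a sequence $(Q_n)_{n\ge0}$ in $\mathbb{M}_2[x]$ with $\deg Q_n=n$, invertible leading coefficient, and $\int_{-1}^1Q_n(x)^*\mathcal{W}_k(x)Q_m(x)\,dx=0$ for $n\ne m$. Define $$\mathcal{D}(\mathcal{W}_k)=\{D\in\mathbb{A}_2\mid \text{for all }n\ge0:\ DQ_n=Q_n\Lambda_n(D)\text{ for some }\Lambda_n(D)\in\mathbb{M}_2\},$$ which is independent of the chosen family. The superscript $(N)$ denotes the subspace of operators of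 order at most $N$ in $\partial_x$ (and $\mathcal{D}(\mathcal{W}_k)^{(-1)}=0$). Finally $$\mathcal{D}_k=\begin{pmatrix}-x & -1 \\ 1 & x\end{pmatrix}\partial_x+\begin{pmatrix}-\rho(k) & k_1 \\ 0 & 1+\rho(k)\end{pmatrix}.$$ *)

theory Defs
  imports
    "HOL-Analysis.Analysis"
    "HOL-Computational_Algebra.Polynomial"
    "HOL-Library.Set_Algebras"
    "Jordan_Normal_Form.Missing_VectorSpace"
begin

text \<open>
  Matrix polynomials are matrices of polynomials, so that the product of \<open>\<complex>[x] \<otimes> M\<^sub>2\<close> is the
  library's matrix product \<open>**\<close>.
\<close>

type_synonym cmat2 = "complex ^ 2 ^ 2"
type_synonym pmat2 = "complex poly ^ 2 ^ 2"

definition mat2 :: "'a::zero \<Rightarrow> 'a \<Rightarrow> 'a \<Rightarrow> 'a \<Rightarrow> 'a ^ 2 ^ 2" where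
  "mat2 a b c d = vector [vector [a, b], vector [c, d]]"

lemma mat2_nth:
  "mat2 a b c d $ 1 $ 1 = a" "mat2 a b c d $ 1 $ 2 = b"
  "mat2 a b c d $ 2 $ 1 = c" "mat2 a b c d $ 2 $ 2 = d"
  by (simp_all add: mat2_def)

definition const_pmat :: "cmat2 \<Rightarrow> pmat2" where
  "const_pmat A = (\<chi> i j. [: A $ i $ j :])"

definition smult_pmat :: "complex \<Rightarrow> pmat2 \<Rightarrow> pmat2" where
  "smult_pmat c P = (\<chi> i j. Polynomial.smult c (P $ i $ j))"

definition pderiv_pmat :: "pmat2 \<Rightarrow> pmat2" where
  "pderiv_pmat P = (\<chi> i j. pderiv (P $ i $ j))"

definition eval_pmat :: "pmat2 \<Rightarrow> complex \<Rightarrow> cmat2" where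
  "eval_pmat P z = (\<chi> i j. poly (P $ i $ j) z)"

definition coeff_pmat :: "pmat2 \<Rightarrow> nat \<Rightarrow> cmat2" where
  "coeff_pmat P n = (\<chi> i j. Polynomial.coeff (P $ i $ j) n)"

definition degree_pmat :: "pmat2 \<Rightarrow> nat" where
  "degree_pmat P = Max {Polynomial.degree (P $ i $ j) | i j. True}"

definition conj_transpose :: "cmat2 \<Rightarrow> cmat2" where
  "conj_transpose A = (\<chi> i j. cnj (A $ j $ i))"

text \<open>
  An element \<open>\<Sum>\<^sub>i A\<^sub>i(x) \<partial>\<^sup>i\<close> of the matrix Weyl algebra is the polynomial in \<open>\<partial>\<close> with left
  coefficients \<open>A\<^sub>i\<close>; the type is used for its additive structure only. The multiplication of
  type \<open>poly\<close> (whose coefficients would be multiplied entrywise and would commute with \<open>\<partial>\<close>) is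
  not the one of the Weyl algebra, which is \<open>weyl_mult\<close>. The order of a nonzero operator is
  its \<open>Polynomial.degree\<close>.
\<close>

type_synonym weyl2 = "pmat2 poly"

definition weyl_smult :: "complex \<Rightarrow> weyl2 \<Rightarrow> weyl2" where
  "weyl_smult c D = map_poly (smult_pmat c) D"

definition weyl_apply :: "weyl2 \<Rightarrow> pmat2 \<Rightarrow> pmat2" where
  "weyl_apply D Q = (\<Sum>i\<le>Polynomial.degree D. Polynomial.coeff D i ** (pderiv_pmat ^^ i) Q)"

text \<open>Left multiplication by \<open>\<partial>\<close>, according to \<open>\<partial> A(x) = A(x) \<partial> + A'(x)\<close>.\<close>

definition partial_mult :: "weyl2 \<Rightarrow> weyl2" where
  "partial_mult E = pCons 0 E + map_poly pderiv_pmat E"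

definition weyl_mult :: "weyl2 \<Rightarrow> weyl2 \<Rightarrow> weyl2" where
  "weyl_mult D E =
     (\<Sum>i\<le>Polynomial.degree D. map_poly ((**) (Polynomial.coeff D i)) ((partial_mult ^^ i) E))"

lemma pmat2_mult_zero_add:
  fixes A B C :: pmat2
  shows "0 ** A = 0" "A ** 0 = 0" "(A + B) ** C = A ** C + B ** C" "A ** (B + C) = A ** B + A ** C"
  by (simp_all add: matrix_matrix_mult_def vec_eq_iff sum.distrib algebra_simps)

lemma weyl_apply_bound:
  assumes "Polynomial.degree D \<le> n"
  shows "weyl_apply D Q = (\<Sum>i\<le>n. Polynomial.coeff D i ** (pderiv_pmat ^^ i) Q)"
  unfolding weyl_apply_def
  by (rule sum.mono_neutral_left)
    (use assms in \<open>auto simp: not_le Polynomial.coeff_eq_0 pmat2_mult_zero_add\<close>)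

lemma weyl_apply_0: "weyl_apply 0 Q = 0"
  by (simp add: weyl_apply_def pmat2_mult_zero_add)

lemma weyl_apply_add: "weyl_apply (D + E) Q = weyl_apply D Q + weyl_apply E Q"
proof -
  define n where "n = max (Polynomial.degree D) (Polynomial.degree E)"
  have "Polynomial.degree (D + E) \<le> n" "Polynomial.degree D \<le> n" "Polynomial.degree E \<le> n"
    by (auto simp: n_def intro: Polynomial.degree_add_le)
  then show ?thesis
    by (simp add: weyl_apply_bound pmat2_mult_zero_add sum.distrib)
qed

lemma weyl_apply_sum: "weyl_apply (sum f A) Q = (\<Sum>i\<in>A. weyl_apply (f i) Q)"
  by (induction A rule: infinite_finite_induct) (simp_all add: weyl_apply_0 weyl_apply_add)

lemma matrix_mult_sum_right: "A ** sum f X = (\<Sum>i\<in>X. A ** f i)" for A :: pmat2 and f :: "'i \<Rightarrow> pmat2"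
  by (induction X rule: infinite_finite_induct) (simp_all add: pmat2_mult_zero_add)

lemma weyl_apply_left_mult: "weyl_apply (map_poly ((**) A) E) Q = A ** weyl_apply E Q"
proof -
  have "Polynomial.degree (map_poly ((**) A) E) \<le> Polynomial.degree E"
    by (intro Polynomial.degree_le) (simp add: coeff_map_poly Polynomial.coeff_eq_0 pmat2_mult_zero_add)
  then show ?thesis
    by (simp add: weyl_apply_bound weyl_apply_def[of E] coeff_map_poly pmat2_mult_zero_add matrix_mul_assoc matrix_mult_sum_right)
qed

lemma pderiv_pmat_0: "pderiv_pmat 0 = 0"
  by (simp add: pderiv_pmat_def vec_eq_iff)

lemma pderiv_pmat_sum: "pderiv_pmat (sum f X) = (\<Sum>i\<in>X. pderiv_pmat (f i))"
  by (induction X rule: infinite_finite_induct)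
    (simp_all add: pderiv_pmat_def vec_eq_iff pderiv_add)

lemma pderiv_pmat_mult: "pderiv_pmat (A ** B) = A ** pderiv_pmat B + pderiv_pmat A ** B"
  by (simp add: pderiv_pmat_def matrix_matrix_mult_def vec_eq_iff pderiv_mult
      sum_2 pderiv_add algebra_simps)

lemma weyl_apply_partial_mult: "weyl_apply (partial_mult E) Q = pderiv_pmat (weyl_apply E Q)"
proof -
  define n where "n = Polynomial.degree E"
  have d: "Polynomial.degree (pCons 0 E) \<le> Suc n" "Polynomial.degree (map_poly pderiv_pmat E) \<le> n"
    by (simp_all add: n_def)
      (intro Polynomial.degree_le, simp add: coeff_map_poly Polynomial.coeff_eq_0 pderiv_pmat_0)
  have "weyl_apply (pCons 0 E) Q = (\<Sum>i\<le>n. Polynomial.coeff E i ** pderiv_pmat ((pderiv_pmat ^^ i) Q))"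
    by (simp add: weyl_apply_bound[OF d(1)] sum.atMost_Suc_shift pmat2_mult_zero_add del: sum.atMost_Suc)
  moreover have "weyl_apply (map_poly pderiv_pmat E) Q =
      (\<Sum>i\<le>n. pderiv_pmat (Polynomial.coeff E i) ** (pderiv_pmat ^^ i) Q)"
    by (simp add: weyl_apply_bound[OF d(2)] coeff_map_poly pderiv_pmat_0)
  ultimately show ?thesis
    by (simp add: partial_mult_def weyl_apply_add weyl_apply_bound[of E n] n_def pderiv_pmat_sum
        pderiv_pmat_mult sum.distrib)
qed

text \<open>\<open>weyl_mult\<close> corresponds to composition of operators.\<close>

lemma weyl_apply_weyl_mult: "weyl_apply (weyl_mult D E) Q = weyl_apply D (weyl_apply E Q)"
proof -
  have "weyl_apply ((partial_mult ^^ i) E) Q = (pderiv_pmat ^^ i) (weyl_apply E Q)" for i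
    by (induction i) (simp_all add: weyl_apply_partial_mult)
  then show ?thesis
    by (simp add: weyl_mult_def weyl_apply_sum weyl_apply_left_mult weyl_apply_def[of D])
qed

definition const_op :: "cmat2 \<Rightarrow> weyl2" where
  "const_op A = [: const_pmat A :]"

definition weyl_subalgebra :: "weyl2 set \<Rightarrow> bool" where
  "weyl_subalgebra A \<longleftrightarrow> 0 \<in> A \<and> (\<forall>c. \<forall>D\<in>A. weyl_smult c D \<in> A) \<and>
     (\<forall>D\<in>A. \<forall>E\<in>A. D + E \<in> A \<and> weyl_mult D E \<in> A)"

definition generated_subalgebra :: "weyl2 set \<Rightarrow> weyl2 set" where
  "generated_subalgebra X = weyl_subalgebra hull X"

definition rho :: "real \<Rightarrow> real \<Rightarrow> real" where
  "rho k1 k2 = (k1 + 2 * k2) / 2"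

definition scalar_weight :: "real \<Rightarrow> real \<Rightarrow> real \<Rightarrow> real" where
  "scalar_weight k1 k2 x =
     2 powr (k1 + 2 * k2) * (1 - x) powr (k1 + k2 - 1/2) * (1 + x) powr (k2 - 1/2)"

definition weight :: "real \<Rightarrow> real \<Rightarrow> real \<Rightarrow> cmat2" where
  "weight k1 k2 x = scalar_weight k1 k2 x *\<^sub>R mat2 1 (of_real x) (of_real x) 1"

definition matrix_orthogonal_polynomials :: "(real \<Rightarrow> cmat2) \<Rightarrow> (nat \<Rightarrow> pmat2) \<Rightarrow> bool" where
  "matrix_orthogonal_polynomials W Q \<longleftrightarrow>
     (\<forall>n. degree_pmat (Q n) = n \<and> invertible (coeff_pmat (Q n) n)) \<and>
     (\<forall>n m. n \<noteq> m \<longrightarrow>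
        (LINT x:{-1<..<1}|lborel.
           conj_transpose (eval_pmat (Q n) (of_real x)) ** W x ** eval_pmat (Q m) (of_real x)) = 0)"

text \<open>
  The condition does not depend on the family \<open>Q\<close>; it is required here for every family, which
  avoids choosing one.
\<close>

definition diff_op_algebra :: "(real \<Rightarrow> cmat2) \<Rightarrow> weyl2 set" where
  "diff_op_algebra W = {D. \<forall>Q. matrix_orthogonal_polynomials W Q \<longrightarrow>
     (\<forall>n. \<exists>\<Lambda>. weyl_apply D (Q n) = Q n ** const_pmat \<Lambda>)}"

text \<open>Here \<open>N\<close> is an integer so that \<open>N = -1\<close> is allowed; it gives the zero space.\<close>

definition diff_op_algebra_upto :: "(real \<Rightarrow> cmat2) \<Rightarrow> int \<Rightarrow> weyl2 set" where
  "diff_op_algebra_upto W N =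
     {D \<in> diff_op_algebra W. D = 0 \<or> int (Polynomial.degree D) \<le> N}"

definition S_op :: weyl2 where
  "S_op = const_op (mat2 0 1 1 0)"

definition D_op :: "real \<Rightarrow> real \<Rightarrow> weyl2" where
  "D_op k1 k2 =
     [: const_pmat (mat2 (of_real (- rho k1 k2)) (of_real k1) 0 (of_real (1 + rho k1 k2))),
        mat2 (- [:0, 1:]) (-1) 1 [:0, 1:] :]"

definition complex_field :: "complex ring" where
  "complex_field = \<lparr>carrier = UNIV, monoid.mult = (*), one = 1, ring.zero = 0, add = (+)\<rparr>"

text \<open>
  The quotient space \<open>U/V\<close> with the cosets \<open>D + V\<close> as elements. Addition is elementwise; adding
  \<open>V\<close> after scaling only matters for the scalar \<open>0\<close>. The multiplicative fields of the record
  are irrelevant for a vector space.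
\<close>

definition quotient_space :: "weyl2 set \<Rightarrow> weyl2 set \<Rightarrow> (complex, weyl2 set) module" where
  "quotient_space U V =
     \<lparr>carrier = (\<lambda>D. D +o V) ` U, monoid.mult = undefined, one = undefined,
      ring.zero = V, add = (+), module.smult = (\<lambda>c X. weyl_smult c ` X + V)\<rparr>"

end

theory Submission
  imports Defs
begin

text \<open>
  Write \<open>r = \<rho>(k) + 1/2\<close>, \<open>h = k\<^sub>1/2\<close> and \<open>\<sigma> = x\<^sup>2 - 1\<close>, and let \<open>\<ell>\<close> be the matrix with rows
  \<open>(-x, -1)\<close> and \<open>(1, x)\<close>, the leading coefficient of \<open>\<D>\<^sub>k\<close>; it satisfies \<open>\<ell>\<^sup>2 = \<sigma> I\<close>.

  The generators belong to the algebra. The swap \<open>S\<close> commutes with the weight matrix, so it is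
  symmetric for the inner product \<open>\<langle>P, Q\<rangle> = \<integral> P\<^sup>* W Q\<close>. So is \<open>L = \<D>\<^sub>k - I/2 - h S\<close>: the integrand of
  \<open>\<langle>LP, Q\<rangle> - \<langle>P, LQ\<rangle>\<close> is the derivative of \<open>(1 - x\<^sup>2) w\<close> times a polynomial, which vanishes at both
  ends (\<open>moment_boundary\<close>, \<open>shifted_op_symmetric\<close>). A symmetric operator that does not raise degrees
  maps \<open>Q\<^sub>n\<close> to a polynomial of degree at most \<open>n\<close> that is orthogonal to all lower degrees, and the
  inner product is definite, hence the image is \<open>Q\<^sub>n \<Lambda>\<close> (\<open>symmetric_op_in_diff_op_algebra\<close>).

  The algebra contains nothing else. Put \<open>J = L\<^sup>2\<close>. Its leading coefficient is the scalar \<open>\<sigma>\<close>, and on the leading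
  coefficient of a polynomial of degree \<open>n\<close> it acts as the scalar \<open>(n + r)\<^sup>2 - h\<^sup>2\<close>. These numbers
  are distinct because \<open>r > 0\<close>, so a triangular system yields an eigenpolynomial in every
  degree, and the symmetry of \<open>J\<close> makes them orthogonal (\<open>orthogonal_eigenfamily\<close>). On this family
  an operator \<open>D\<close> of the algebra commutes with \<open>J\<close>, since the eigenvalues of \<open>J\<close> are scalars.
  Therefore \<open>D J = J D\<close> in the Weyl algebra, which acts faithfully on polynomials
  (\<open>diff_op_algebra_commutes\<close>).

  If \<open>D\<close> has leading coefficient \<open>A\<close> and order \<open>N\<close>, comparing the coefficients of \<open>\<partial>\<^sup>N\<^sup>+\<^sup>1\<close> in
  \<open>D J = J D\<close> gives \<open>2 \<sigma> A' = [A, T] + N \<sigma>' A\<close>, where \<open>T\<close> is the coefficient of \<open>\<partial>\<close> in \<open>J\<close> and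
  differs from \<open>- S\<close> by a scalar polynomial. In suitable linear combinations of the entries
  of \<open>A\<close> this becomes four scalar equations \<open>(1 - x\<^sup>2) f' = (\<epsilon> - N x) f\<close> with \<open>\<epsilon> = 0, 0, 1, -1\<close>. The
  candidates for solutions are \<open>(1 - x)\<^sup>s (1 + x)\<^sup>t\<close> with \<open>s = (N - \<epsilon>)/2\<close> and \<open>t = (N + \<epsilon>)/2\<close>, so
  only those with \<open>N - \<epsilon>\<close> even survive, two for each parity of \<open>N\<close>. They combine to
  \<open>A = (\<alpha> I + \<beta> S) \<ell>\<^sup>N\<close> (\<open>commuting_leading_coeff\<close>), which is the leading coefficient of
  \<open>(\<alpha> I + \<beta> S) \<D>\<^sub>k\<^sup>N\<close>. Subtracting that operator lowers the order; induction on the order shows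
  that the algebra is generated as claimed. The same step shows that \<open>\<D>\<^sub>k\<^sup>N\<close> and \<open>S \<D>\<^sub>k\<^sup>N\<close> span the
  quotient, and they are independent in it because \<open>\<ell>\<close> is invertible over rational functions.
\<close>

section \<open>Integration of polynomials against the Jacobi weight\<close>

text \<open>
  The substitution \<open>t = (1 + x)/2\<close> turns this into the Beta integral.
\<close>

lemma powr_times_powr_integrable:
  fixes a b :: real
  assumes "a > -1" and "b > -1"
  shows "set_integrable lborel {-1<..<1} (\<lambda>x. (1 - x) powr a * (1 + x) powr b)"
proof -
  let ?g = "\<lambda>t::real. t powr b * (1 - t) powr a"
  have "(?g has_integral Beta (b + 1) (a + 1)) {0<..<1}"
    using has_integral_Beta_real[of "b + 1" "a + 1"] assms by (simp add: has_integral_Icc_iff_Ioo)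
  then have "?g absolutely_integrable_on {0<..<1}"
    by (intro nonnegative_absolutely_integrable_1) (auto simp: integrable_on_def)
  then have "integrable lborel (\<lambda>t. indicator {0<..<1} t *\<^sub>R ?g t)"
    unfolding set_integrable_def by (subst (asm) integrable_completion) auto
  then have "integrable lborel (\<lambda>x. indicator {0<..<1} (1/2 + 1/2 * x) *\<^sub>R ?g (1/2 + 1/2 * x))"
    by (rule lborel_integrable_real_affine) simp
  then have "integrable lborel (\<lambda>x. 2 powr (a + b) * (indicator {0<..<1} (1/2 + 1/2 * x) *\<^sub>R ?g (1/2 + 1/2 * x)))"
    by (rule integrable_mult_right)
  moreover have "2 powr (a + b) * (indicator {0<..<1} (1/2 + 1/2 * x) *\<^sub>R ?g (1/2 + 1/2 * x))
      = indicator {-1<..<1} x *\<^sub>R ((1 - x) powr a * (1 + x) powr b)" for x :: real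
  proof (cases "x \<in> {-1<..<1}")
    case True
    then have "1/2 + 1/2 * x = (1 + x) / 2" "1 - (1/2 + 1/2 * x) = (1 - x) / 2" by (auto simp: field_simps)
    moreover from this True have "(1/2 + 1/2 * x) \<in> {0<..<1}" by auto
    ultimately show ?thesis
      using True by (simp only: powr_divide powr_add indicator_simps) (simp add: powr_divide)
  qed (auto simp: indicator_def)
  ultimately show ?thesis unfolding set_integrable_def by (simp only:)
qed

definition moment :: "real \<Rightarrow> real \<Rightarrow> complex poly \<Rightarrow> complex" where
  "moment k1 k2 p =
     (LINT x:{-1<..<1}|lborel. scalar_weight k1 k2 x *\<^sub>R poly p (of_real x))"

context
  fixes k1 k2 :: real
  assumes k1: "k1 \<ge> 0" and k2: "k2 \<ge> 0"
begin

lemma weighted_poly_integrable: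
  "set_integrable lborel {-1<..<1} (\<lambda>x. scalar_weight k1 k2 x *\<^sub>R poly p (complex_of_real x))"
proof -
  have w: "set_integrable lborel {-1<..<1} (scalar_weight k1 k2)"
    unfolding scalar_weight_def mult.assoc
    by (intro set_integrable_mult_right powr_times_powr_integrable) (use k1 k2 in auto)
  have "bounded ((\<lambda>x. poly p (complex_of_real x)) ` {-1..1})"
    by (intro compact_imp_bounded compact_continuous_image) (auto intro!: continuous_intros)
  then obtain C where C: "\<And>x. x \<in> {-1..1} \<Longrightarrow> norm (poly p (complex_of_real x)) \<le> C"
    unfolding bounded_iff by blast
  have m: "(\<lambda>x. poly p (complex_of_real x)) \<in> borel_measurable borel"
    by (intro borel_measurable_continuous_onI continuous_intros)
  have "set_integrable lborel {-1<..<1} (\<lambda>x. scalar_weight k1 k2 x * C)"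
    using w by (intro set_integrable_mult_left) auto
  then show ?thesis
    unfolding set_integrable_def
  proof (rule Bochner_Integration.integrable_bound)
    show "(\<lambda>x. indicator {-1<..<1} x *\<^sub>R scalar_weight k1 k2 x *\<^sub>R poly p (complex_of_real x)) \<in> borel_measurable lborel"
      unfolding scalar_weight_def using m by measurable
    have "scalar_weight k1 k2 x \<ge> 0" for x by (simp add: scalar_weight_def)
    then show "AE x in lborel. norm (indicator {-1<..<1} x *\<^sub>R scalar_weight k1 k2 x *\<^sub>R poly p (complex_of_real x))
        \<le> norm (indicator {-1<..<1} x *\<^sub>R (scalar_weight k1 k2 x * C))"
      using C by (intro AE_I2) (force simp: indicator_def abs_mult intro!: mult_left_mono order.trans[OF _ abs_ge_self])
  qed
qed

lemma moment_add: "moment k1 k2 (p + q) = moment k1 k2 p + moment k1 k2 q"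
  using set_integral_add(2)[OF weighted_poly_integrable[of p] weighted_poly_integrable[of q]]
  by (simp add: moment_def scaleR_add_right)

lemma moment_smult: "moment k1 k2 (Polynomial.smult c p) = c * moment k1 k2 p"
  by (simp add: moment_def flip: set_integral_mult_right)

text \<open>
  Up to the constant in the weight, the integrand is the derivative of
  \<open>(1 - x)\<^sup>a (1 + x)\<^sup>b h(x)\<close> with \<open>a = k\<^sub>1 + k\<^sub>2 + 1/2\<close> and \<open>b = k\<^sub>2 + 1/2\<close>. Both exponents are positive, so
  this function vanishes at the end points. All symmetry statements reduce to this identity.
\<close>

lemma moment_boundary:
  "moment k1 k2 ((1 - [:0,1:]^2) * pderiv h - [:of_real k1, of_real (2 * rho k1 k2 + 1):] * h) = 0"
proof -
  define a b where "a = k1 + k2 + 1/2" and "b = k2 + 1/2"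
  define F where "F = (\<lambda>x. (2 powr (k1 + 2 * k2) * ((1 - x) powr a * (1 + x) powr b)) *\<^sub>R poly h (complex_of_real x))"
  define f where "f = (\<lambda>x. scalar_weight k1 k2 x *\<^sub>R poly ((1 - [:0,1:]^2) * pderiv h - [:of_real k1, of_real (2 * rho k1 k2 + 1):] * h) (complex_of_real x))"
  have ab: "a > 0" "b > 0" using k1 k2 by (auto simp: a_def b_def)
  have cont: "continuous_on {-1..1} F"
    unfolding F_def using ab
    by (intro continuous_intros continuous_on_powr') auto
  have deriv: "(F has_vector_derivative f x) (at x)" if x: "-1 < x" "x < 1" for x
  proof -
    have p: "(1 - x) powr a = (1 - x) * (1 - x) powr (k1 + k2 - 1/2)" 
      "(1 + x) powr b = (1 + x) * (1 + x) powr (k2 - 1/2)"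
      using x powr_mult_base[of "1 - x" "k1 + k2 - 1/2"] powr_mult_base[of "1 + x" "k2 - 1/2"]
      by (simp_all add: a_def b_def add_ac)
    have q: "a - 1 = k1 + k2 - 1/2" "b - 1 = k2 - 1/2" by (simp_all add: a_def b_def)
    have d1: "((\<lambda>x. 2 powr (k1 + 2 * k2) * ((1 - x) powr a * (1 + x) powr b)) has_real_derivative
        scalar_weight k1 k2 x * (b * (1 - x) - a * (1 + x))) (at x)"
      using x by (auto intro!: derivative_eq_intros simp: q)
         (simp add: p scalar_weight_def algebra_simps)
    have d2: "((\<lambda>x. poly h (complex_of_real x)) has_vector_derivative poly (pderiv h) (complex_of_real x)) (at x)"
      by (rule has_vector_derivative_real_field) (rule poly_DERIV)
    have "(F has_vector_derivative ((2 powr (k1 + 2 * k2) * ((1 - x) powr a * (1 + x) powr b)) *\<^sub>R poly (pderiv h) (complex_of_real x)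
       + (scalar_weight k1 k2 x * (b * (1 - x) - a * (1 + x))) *\<^sub>R poly h (complex_of_real x))) (at x)"
      unfolding F_def by (rule has_vector_derivative_scaleR[OF d1 d2])
    moreover have "(2 powr (k1 + 2 * k2) * ((1 - x) powr a * (1 + x) powr b)) = scalar_weight k1 k2 x * (1 - x\<^sup>2)"
      by (simp add: p scalar_weight_def power2_eq_square algebra_simps)
    moreover have "b * (1 - x) - a * (1 + x) = - (k1 + (2 * rho k1 k2 + 1) * x)"
      by (simp add: a_def b_def rho_def field_simps)
    moreover have "f x = (scalar_weight k1 k2 x * (1 - x\<^sup>2)) *\<^sub>R poly (pderiv h) (complex_of_real x)
       + (scalar_weight k1 k2 x * - (k1 + (2 * rho k1 k2 + 1) * x)) *\<^sub>R poly h (complex_of_real x)"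
      by (simp add: f_def scaleR_conv_of_real algebra_simps)
    ultimately show ?thesis
      by (simp only:)
  qed
  have "(LBINT x=ereal (-1)..ereal 1. f x) = 0 - 0"
  proof (rule interval_integral_FTC_integrable)
    show "ereal (-1) < ereal 1" by (simp only: less_ereal.simps)
    show "(F has_vector_derivative f x) (at x)" if "ereal (-1) < ereal x" "ereal x < ereal 1" for x
      using that by (intro deriv) (simp_all only: less_ereal.simps)
    show "isCont f x" if "ereal (-1) < ereal x" "ereal x < ereal 1" for x
    proof -
      have "-1 < x" "x < 1" using that by (simp_all only: less_ereal.simps)
      then show ?thesis unfolding f_def scalar_weight_def by (auto intro!: continuous_intros)
    qed
    show "set_integrable lborel (einterval (ereal (-1)) (ereal 1)) f"
      unfolding einterval_eq_Icc f_def by (rule weighted_poly_integrable)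
    have "(F \<longlongrightarrow> F (-1)) (at_right (-1))" "(F \<longlongrightarrow> F 1) (at_left 1)"
      using cont by (simp_all add: continuous_on_Icc_at_rightD continuous_on_Icc_at_leftD)
    moreover have "F (-1) = 0" "F 1 = 0" by (simp_all add: F_def)
    ultimately show "((F \<circ> real_of_ereal) \<longlongrightarrow> 0) (at_right (ereal (-1)))"
      "((F \<circ> real_of_ereal) \<longlongrightarrow> 0) (at_left (ereal 1))"
      by (simp_all only: ereal_tendsto_simps1)
  qed
  then have "(LBINT x:einterval (ereal (-1)) (ereal 1). f x) = 0"
    unfolding interval_lebesgue_integral_def by simp
  then show ?thesis
    by (simp only: f_def moment_def einterval_eq_Icc)
qed

text \<open>
  A nonnegative integrand with integral zero vanishes almost everywhere, whereas a nonzero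
  polynomial vanishes only at finitely many points.
\<close>

lemma moment_eq_0_iff_nonneg:
  assumes nonneg: "\<And>x. -1 < x \<Longrightarrow> x < 1 \<Longrightarrow> poly p (complex_of_real x) = of_real (g x) \<and> g x \<ge> 0"
    and zero: "moment k1 k2 p = 0"
  shows "p = 0"
proof (rule ccontr)
  assume "p \<noteq> 0"
  let ?f = "\<lambda>x. indicator {-1<..<1} x *\<^sub>R scalar_weight k1 k2 x *\<^sub>R poly p (complex_of_real x)"
  have int: "integrable lborel ?f"
    using weighted_poly_integrable[of p] by (simp add: set_integrable_def)
  have "(LINT x|lborel. Re (?f x)) = 0"
    using zero integral_Re[OF int] by (simp add: moment_def set_lebesgue_integral_def)
  moreover have "Re (?f x) \<ge> 0" for x
    using nonneg[of x] by (auto simp: indicator_def scalar_weight_def)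
  ultimately have "AE x in lborel. Re (?f x) = 0"
    using integral_nonneg_eq_0_iff_AE[of lborel "\<lambda>x. Re (?f x)"] integrable_Re[OF int] by auto
  moreover have "AE x in lborel. x \<notin> {x. poly p (complex_of_real x) = 0}"
  proof (rule AE_not_in, rule finite_imp_null_set_lborel)
    have "finite (complex_of_real -` {z. poly p z = 0})"
      using poly_roots_finite[OF \<open>p \<noteq> 0\<close>] by (intro finite_vimageI) (auto simp: inj_on_def)
    then show "finite {x. poly p (complex_of_real x) = 0}" by (simp add: vimage_def)
  qed
  ultimately have "AE x in lborel. x \<notin> {-1<..<1::real}"
  proof eventually_elim
    case (elim x)
    show ?case
    proof
      assume x: "x \<in> {-1<..<1}"
      then have "scalar_weight k1 k2 x > 0" by (auto simp: scalar_weight_def)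
      with elim x nonneg[of x] show False by auto
    qed
  qed
  then have "emeasure lborel {-1<..<1::real} = 0"
    by (subst (asm) AE_iff_null_sets[symmetric]) (auto simp: null_sets_def)
  then show False by simp
qed

end

section \<open>The matrix-valued inner product\<close>

lemmas mat2_entries = vec_eq_iff forall_2 matrix_matrix_mult_def sum_2 mat2_nth

definition adjoint_pmat :: "pmat2 \<Rightarrow> pmat2" where
  "adjoint_pmat P = (\<chi> i j. map_poly cnj (P $ j $ i))"

text \<open>
  The polynomial factor of the weight; the scalar factor enters through \<open>moment\<close>. In this way
  every identity between integrals becomes one between polynomials.
\<close>

definition weight_pmat :: pmat2 where
  "weight_pmat = mat2 1 [:0, 1:] [:0, 1:] 1"

definition gram :: "pmat2 \<Rightarrow> pmat2 \<Rightarrow> pmat2" where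
  "gram P Q = adjoint_pmat P ** weight_pmat ** Q"

text \<open>
  The inner product \<open>\<integral> P\<^sup>* W Q\<close>, defined entry by entry; \<open>LINT_eval_gram\<close> identifies it with the
  integral of the matrix-valued function.
\<close>

definition inner_pmat :: "real \<Rightarrow> real \<Rightarrow> pmat2 \<Rightarrow> pmat2 \<Rightarrow> cmat2" where
  "inner_pmat k1 k2 P Q = (\<chi> i j. moment k1 k2 (gram P Q $ i $ j))"

lemma map_poly_cnj_add: "map_poly cnj (p + q) = map_poly cnj p + map_poly cnj q"
  by (simp add: poly_eq_iff coeff_map_poly)

lemma map_poly_cnj_mult: "map_poly cnj (p * q) = map_poly cnj p * map_poly cnj q"
  by (simp add: poly_eq_iff coeff_map_poly coeff_mult)

lemma map_poly_cnj_smult: "map_poly cnj (Polynomial.smult c p) = Polynomial.smult (cnj c) (map_poly cnj p)"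
  by (simp add: poly_eq_iff coeff_map_poly)

lemma map_poly_cnj_pCons: "map_poly cnj (pCons c p) = pCons (cnj c) (map_poly cnj p)"
  by (simp add: map_poly_pCons)

lemma map_poly_cnj_uminus: "map_poly cnj (- p) = - map_poly cnj p"
  by (simp add: poly_eq_iff coeff_map_poly)

lemma map_poly_cnj_1: "map_poly cnj 1 = 1"
  by (simp add: map_poly_1)

lemma map_poly_cnj_pderiv: "map_poly cnj (pderiv p) = pderiv (map_poly cnj p)"
  by (simp add: poly_eq_iff coeff_map_poly coeff_pderiv)

lemmas map_poly_cnj_simps = map_poly_cnj_add map_poly_cnj_mult map_poly_cnj_smult
  map_poly_cnj_pCons map_poly_cnj_uminus map_poly_cnj_1 map_poly_cnj_pderiv

lemma poly_map_cnj_of_real: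
  "poly (map_poly cnj p) (complex_of_real x) = cnj (poly p (of_real x))"
  by (metis poly_cnj complex_cnj_complex_of_real)

lemma eval_gram:
  "conj_transpose (eval_pmat P (of_real x)) ** weight k1 k2 x ** eval_pmat Q (of_real x)
     = scalar_weight k1 k2 x *\<^sub>R eval_pmat (gram P Q) (of_real x)"
  by (simp add: mat2_entries conj_transpose_def eval_pmat_def weight_def gram_def adjoint_pmat_def
      weight_pmat_def poly_map_cnj_of_real scaleR_conv_of_real[where 'a = complex] algebra_simps)

context
  fixes k1 k2 :: real
  assumes k1: "k1 \<ge> 0" and k2: "k2 \<ge> 0"
begin

lemma LINT_eval_gram:
  "(LINT x:{-1<..<1}|lborel.
      conj_transpose (eval_pmat P (of_real x)) ** weight k1 k2 x ** eval_pmat Q (of_real x))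
     = inner_pmat k1 k2 P Q"
proof -
  let ?f = "\<lambda>i j x. indicator {-1<..<1} x *\<^sub>R scalar_weight k1 k2 x *\<^sub>R poly (gram P Q $ i $ j) (complex_of_real x)"
  let ?F = "\<lambda>x. indicator {-1<..<1} x *\<^sub>R scalar_weight k1 k2 x *\<^sub>R eval_pmat (gram P Q) (complex_of_real x)"
  have "bounded_linear (\<lambda>z::complex. axis i (axis j z) :: cmat2)" for i j :: 2
    by (intro linear_conv_bounded_linear[THEN iffD1] linearI) (auto simp: vec_eq_iff axis_def)
  moreover have "integrable lborel (?f i j)" for i j
    using weighted_poly_integrable[OF k1 k2] by (simp add: set_integrable_def)
  ultimately have "integrable lborel (\<lambda>x. axis i (axis j (?f i j x)) :: cmat2)" for i j
    by (rule integrable_bounded_linear)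
  then have "integrable lborel (\<lambda>x. \<Sum>i\<in>UNIV. \<Sum>j\<in>UNIV. axis i (axis j (?f i j x)) :: cmat2)"
    by (intro Bochner_Integration.integrable_sum) auto
  moreover have "(\<Sum>i\<in>UNIV. \<Sum>j\<in>UNIV. axis i (axis j (?f i j x)) :: cmat2) = ?F x" for x
    by (simp add: vec_eq_iff forall_2 sum_2 axis_def eval_pmat_def)
  ultimately have int: "integrable lborel ?F" by (simp only:)
  have "integral\<^sup>L lborel ?F $ i $ j = moment k1 k2 (gram P Q $ i $ j)" for i j
  proof -
    have "bounded_linear (\<lambda>M::cmat2. M $ i $ j)"
      using bounded_linear_compose[OF bounded_linear_vec_nth[of j] bounded_linear_vec_nth[of i]] .
    from integral_bounded_linear[OF this int]
    show ?thesis by (simp add: moment_def set_lebesgue_integral_def eval_pmat_def)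
  qed
  then show ?thesis
    by (simp add: eval_gram set_lebesgue_integral_def inner_pmat_def vec_eq_iff)
qed

lemma inner_add_left: "inner_pmat k1 k2 (P + P') Q = inner_pmat k1 k2 P Q + inner_pmat k1 k2 P' Q"
proof -
  have "gram (P + P') Q = gram P Q + gram P' Q"
    by (simp add: mat2_entries gram_def adjoint_pmat_def map_poly_cnj_simps algebra_simps)
  then show ?thesis by (simp add: inner_pmat_def moment_add[OF k1 k2] vec_eq_iff)
qed

lemma inner_add_right: "inner_pmat k1 k2 P (Q + Q') = inner_pmat k1 k2 P Q + inner_pmat k1 k2 P Q'"
  by (simp add: inner_pmat_def gram_def pmat2_mult_zero_add moment_add[OF k1 k2] vec_eq_iff)

lemma inner_const_right: "inner_pmat k1 k2 P (Q ** const_pmat C) = inner_pmat k1 k2 P Q ** C"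
proof -
  have "gram P (Q ** const_pmat C) = gram P Q ** const_pmat C"
    by (simp add: gram_def matrix_mul_assoc)
  then show ?thesis
    by (simp add: inner_pmat_def mat2_entries const_pmat_def moment_add[OF k1 k2]
        moment_smult[OF k1 k2] mult.commute)
qed

lemma inner_const_left:
  "inner_pmat k1 k2 (P ** const_pmat C) Q = conj_transpose C ** inner_pmat k1 k2 P Q"
proof -
  have "gram (P ** const_pmat C) Q = const_pmat (conj_transpose C) ** gram P Q"
    by (simp add: mat2_entries gram_def adjoint_pmat_def map_poly_cnj_simps algebra_simps
        const_pmat_def conj_transpose_def)
  then show ?thesis
    by (simp add: inner_pmat_def mat2_entries const_pmat_def moment_add[OF k1 k2]
        moment_smult[OF k1 k2])
qed

lemma inner_0: "inner_pmat k1 k2 P 0 = 0" "inner_pmat k1 k2 0 Q = 0"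
  using inner_add_right[of P 0 0] inner_add_left[of 0 0 Q] by simp_all

text \<open>
  The diagonal entry of the integrand that belongs to a column \<open>(a, b)\<close> is \<open>(1 + x)/2 |a + b|\<^sup>2 + (1 - x)/2 |a - b|\<^sup>2\<close>, which is nonnegative on \<open>(-1, 1)\<close>.
\<close>

lemma inner_definite:
  assumes "inner_pmat k1 k2 R R = 0"
  shows "R = 0"
proof -
  have "R $ 1 $ j = 0 \<and> R $ 2 $ j = 0" for j
  proof -
    define a b where "a = R $ 1 $ j" and "b = R $ 2 $ j"
    define g where "g = (\<lambda>x. (1 + x) / 2 * (cmod (poly (a + b) (of_real x)))\<^sup>2
       + (1 - x) / 2 * (cmod (poly (a - b) (of_real x)))\<^sup>2)"
    have "poly (gram R R $ j $ j) (of_real x) = of_real (g x)" for x :: real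
    proof -
      have "cnj A * A + cnj B * B + of_real x * (cnj A * B + cnj B * A)
          = of_real ((1 + x) / 2 * (cmod (A + B))\<^sup>2 + (1 - x) / 2 * (cmod (A - B))\<^sup>2)" for A B
        by (simp add: complex_norm_square del: of_real_power) (simp add: field_simps)
      moreover have "gram R R $ j $ j = map_poly cnj a * a + map_poly cnj b * b
          + [:0, 1:] * (map_poly cnj a * b + map_poly cnj b * a)"
        by (simp add: gram_def adjoint_pmat_def weight_pmat_def mat2_entries a_def b_def algebra_simps)
      ultimately show ?thesis
        by (simp add: g_def poly_map_cnj_of_real)
    qed
    note g = this
    have "gram R R $ j $ j = 0"
    proof (rule moment_eq_0_iff_nonneg[OF k1 k2, where g = g])
      show "moment k1 k2 (gram R R $ j $ j) = 0"
        using assms by (simp add: inner_pmat_def vec_eq_iff)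
    qed (use g in \<open>auto simp: g_def\<close>)
    with g have "g x = 0" for x by (metis of_real_eq_0_iff poly_0)
    then have z: "poly (a + b) (of_real x) = 0 \<and> poly (a - b) (of_real x) = 0" if "-1 < x" "x < 1" for x
      using that add_nonneg_eq_0_iff[of "(1 + x) / 2 * (cmod (poly (a + b) (of_real x)))\<^sup>2"
         "(1 - x) / 2 * (cmod (poly (a - b) (of_real x)))\<^sup>2"]
      by (auto simp: g_def)
    have "p = 0" if "\<And>x. -1 < x \<Longrightarrow> x < 1 \<Longrightarrow> poly p (complex_of_real x) = 0" for p
    proof (rule ccontr)
      assume "p \<noteq> 0"
      then have "finite {z. poly p z = 0}" by (rule poly_roots_finite)
      moreover have "complex_of_real ` {-1<..<1} \<subseteq> {z. poly p z = 0}" using that by auto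
      ultimately have "finite (complex_of_real ` {-1<..<1::real})" by (rule finite_subset[rotated])
      then show False by (auto dest!: finite_imageD simp: inj_on_def infinite_Ioo)
    qed
    with z have "a + b = 0" "a - b = 0" by blast+
    then have "b = a" "a + a = 0" by simp_all
    then show ?thesis by (simp add: a_def b_def flip: mult_2)
  qed
  then show ?thesis by (simp add: vec_eq_iff forall_2)
qed

end

section \<open>Two symmetric operators\<close>

lemma weyl_apply_pCons: "weyl_apply (pCons A D) Q = A ** Q + weyl_apply D (pderiv_pmat Q)"
proof -
  have "weyl_apply (pCons A D) Q =
      (\<Sum>i\<le>Suc (Polynomial.degree D). Polynomial.coeff (pCons A D) i ** (pderiv_pmat ^^ i) Q)"
    by (intro weyl_apply_bound) simp
  then show ?thesis
    by (simp add: sum.atMost_Suc_shift weyl_apply_def funpow_swap1 del: sum.atMost_Suc)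
qed

text \<open>
  With \<open>r = \<rho>(k) + 1/2\<close> and \<open>h = k\<^sub>1/2\<close> this is \<open>\<D>\<^sub>k\<close> minus its part \<open>I/2 + h S\<close> that commutes with
  \<open>S\<close>. What remains anticommutes with \<open>S\<close>; in the eigenbasis of \<open>S\<close> it consists of the two
  first-order operators that exchange, up to constant factors, the Jacobi polynomials with parameters
  \<open>(k\<^sub>1 + k\<^sub>2 - 1/2, k\<^sub>2 + 1/2)\<close> and \<open>(k\<^sub>1 + k\<^sub>2 + 1/2, k\<^sub>2 - 1/2)\<close>.
\<close>

definition shifted_op :: "complex \<Rightarrow> complex \<Rightarrow> weyl2" where
  "shifted_op r h = [: const_pmat (mat2 (- r) h (- h) r), mat2 (- [:0, 1:]) (-1) 1 [:0, 1:] :]"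

text \<open>
  The square of \<open>shifted_op\<close>. In the eigenbasis of \<open>S\<close> it is, up to sign and an additive constant,
  the pair of Jacobi differential operators for these two parameters. Its second-order
  coefficient is scalar, which is what makes commuting with it tractable.
\<close>

definition jacobi_op :: "complex \<Rightarrow> complex \<Rightarrow> weyl2" where
  "jacobi_op r h =
     [: const_pmat (mat2 (r\<^sup>2 - h\<^sup>2) 0 0 (r\<^sup>2 - h\<^sup>2)),
        mat2 [:2 * h, 2 * r + 1:] (-1) (-1) [:2 * h, 2 * r + 1:],
        mat2 [:-1, 0, 1:] 0 0 [:-1, 0, 1:] :]"

lemma weyl_apply_const_op: "weyl_apply (const_op C) Q = const_pmat C ** Q"
  by (simp add: const_op_def weyl_apply_pCons weyl_apply_0)

lemma D_op_eq_shifted_op: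
  "D_op k1 k2 = shifted_op (of_real (rho k1 k2 + 1 / 2)) (of_real (k1 / 2)) + const_op (mat2 (1/2) (of_real (k1 / 2)) (of_real (k1 / 2)) (1/2))"
  by (simp add: D_op_def shifted_op_def const_op_def mat2_entries const_pmat_def)

lemma poly_ext:
  fixes p q :: "complex poly"
  assumes "\<And>x. poly p x = poly q x"
  shows "p = q"
  using assms poly_eq_poly_eq_iff by blast

lemma pderiv_pmat_add: "pderiv_pmat (P + Q) = pderiv_pmat P + pderiv_pmat Q"
  by (simp add: pderiv_pmat_def vec_eq_iff pderiv_add)

lemma pderiv_pmat_const: "pderiv_pmat (const_pmat C) = 0"
  by (simp add: pderiv_pmat_def const_pmat_def vec_eq_iff pderiv_pCons)

lemma shifted_op_square:
  "weyl_apply (shifted_op r h) (weyl_apply (shifted_op r h) Q) = weyl_apply (jacobi_op r h) Q"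
proof -
  let ?C = "const_pmat (mat2 (- r) h (- h) r)" and ?B = "mat2 (- [:0, 1:]) (-1) 1 [:0, 1:] :: pmat2"
  \<comment> \<open>Composition gives \<open>C\<^sup>2 + (C B + B C + B B') \<partial> + B\<^sup>2 \<partial>\<^sup>2\<close> for the operator \<open>C + B \<partial>\<close>.\<close>
  have apply_op: "weyl_apply (shifted_op r h) P = ?C ** P + ?B ** pderiv_pmat P" for P
    by (simp add: shifted_op_def weyl_apply_pCons weyl_apply_0)
  have "weyl_apply (shifted_op r h) (weyl_apply (shifted_op r h) Q) =
      (?C ** ?C) ** Q + ((?C ** ?B + ?B ** ?C + ?B ** pderiv_pmat ?B) ** pderiv_pmat Q
      + (?B ** ?B) ** pderiv_pmat (pderiv_pmat Q))"
    by (simp add: apply_op pderiv_pmat_add pderiv_pmat_const pderiv_pmat_mult pmat2_mult_zero_add matrix_mul_assoc)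
  moreover have "?C ** ?C = const_pmat (mat2 (r\<^sup>2 - h\<^sup>2) 0 0 (r\<^sup>2 - h\<^sup>2))"
    by (simp add: mat2_entries const_pmat_def power2_eq_square)
  moreover have "?C ** ?B + ?B ** ?C + ?B ** pderiv_pmat ?B
      = mat2 [:2 * h, 2 * r + 1:] (-1) (-1) [:2 * h, 2 * r + 1:]"
    by (simp add: mat2_entries const_pmat_def pderiv_pmat_def pderiv_minus pderiv_pCons)
  moreover have "?B ** ?B = mat2 [:-1, 0, 1:] 0 0 [:-1, 0, 1:]"
    by (simp add: mat2_entries one_pCons)
  ultimately show ?thesis
    by (simp add: jacobi_op_def weyl_apply_pCons weyl_apply_0)
qed

text \<open>
  \<open>S\<close> is Hermitian and commutes with the weight matrix.
\<close>

lemma swap_symmetric: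
  "inner_pmat k1 k2 (weyl_apply S_op P) Q = inner_pmat k1 k2 P (weyl_apply S_op Q)"
proof -
  have "gram (weyl_apply S_op P) Q = gram P (weyl_apply S_op Q)"
    by (simp add: S_op_def weyl_apply_const_op mat2_entries gram_def adjoint_pmat_def weight_pmat_def
        const_pmat_def map_poly_cnj_simps algebra_simps)
  then show ?thesis by (simp add: inner_pmat_def)
qed

context
  fixes k1 k2 :: real
  assumes k1: "k1 \<ge> 0" and k2: "k2 \<ge> 0"
begin

lemma moment_diff: "moment k1 k2 (p - q) = moment k1 k2 p - moment k1 k2 q"
  using moment_add[OF k1 k2, of p "Polynomial.smult (-1) q"] moment_smult[OF k1 k2, of "-1" q] by simp

text \<open>
  The difference of the two Gram matrices has entries of the form treated in
  \<open>moment_boundary\<close>, with \<open>h = (P\<^sup>* K Q)\<^sub>i\<^sub>j\<close> for \<open>K\<close> with rows \<open>(0, 1)\<close> and \<open>(-1, 0)\<close>. This \<open>K\<close> appears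
  because \<open>\<ell>\<^sup>T\<close> times the matrix with rows \<open>(1, x)\<close> and \<open>(x, 1)\<close> equals \<open>(1 - x\<^sup>2) K\<close>.
\<close>

lemma shifted_op_symmetric:
  fixes P Q :: pmat2
  defines "L \<equiv> weyl_apply (shifted_op (of_real (rho k1 k2 + 1 / 2)) (of_real (k1 / 2)))"
  shows "inner_pmat k1 k2 (L P) Q = inner_pmat k1 k2 P (L Q)"
proof -
  have "gram (weyl_apply (shifted_op (of_real r) (of_real h)) P) Q $ i $ j -
        gram P (weyl_apply (shifted_op (of_real r) (of_real h)) Q) $ i $ j
      = (1 - [:0,1:]^2) * pderiv (map_poly cnj (P $ 1 $ i) * Q $ 2 $ j - map_poly cnj (P $ 2 $ i) * Q $ 1 $ j)
        - [:of_real (2 * h), of_real (2 * r):]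
          * (map_poly cnj (P $ 1 $ i) * Q $ 2 $ j - map_poly cnj (P $ 2 $ i) * Q $ 1 $ j)" for i j and r h :: real
    by (rule poly_ext)
      (simp add: gram_def adjoint_pmat_def weight_pmat_def shifted_op_def weyl_apply_pCons weyl_apply_0
        mat2_entries const_pmat_def pderiv_pmat_def pderiv_mult pderiv_diff map_poly_cnj_simps
        del: of_real_mult, simp add: algebra_simps power2_eq_square)
  from this[of "rho k1 k2 + 1 / 2" "k1 / 2"]
  have "moment k1 k2 (gram (L P) Q $ i $ j) - moment k1 k2 (gram P (L Q) $ i $ j) = 0" for i j
    using moment_boundary[OF k1 k2] by (simp add: L_def distrib_left flip: moment_diff)
  then show ?thesis by (simp add: inner_pmat_def)
qed

end

section \<open>Degrees and coefficients of matrix polynomials\<close>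

text \<open>
  Strict bounds give the zero polynomial the bound \<open>0\<close>, so that inductions on the degree can
  start there.
\<close>

definition degree_less :: "pmat2 \<Rightarrow> nat \<Rightarrow> bool" where
  "degree_less P n \<longleftrightarrow> (\<forall>m\<ge>n. coeff_pmat P m = 0)"

lemma coeff_pmat_simps:
  "coeff_pmat (P + Q) n = coeff_pmat P n + coeff_pmat Q n"
  "coeff_pmat (P - Q) n = coeff_pmat P n - coeff_pmat Q n"
  "coeff_pmat 0 n = 0"
  "coeff_pmat (P ** const_pmat C) n = coeff_pmat P n ** C"
  "coeff_pmat (const_pmat C ** P) n = C ** coeff_pmat P n"
  by (simp_all add: coeff_pmat_def mat2_entries const_pmat_def mult.commute)

lemma pmat_eq_0_iff_coeff: "P = 0 \<longleftrightarrow> (\<forall>n. coeff_pmat P n = 0)"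
  by (auto simp: coeff_pmat_def vec_eq_iff poly_eq_iff)

lemma degree_less_0: "degree_less P 0 \<longleftrightarrow> P = 0"
  by (simp add: degree_less_def pmat_eq_0_iff_coeff)

lemma cmat2_mult_0: "0 ** (C::cmat2) = 0" "(C::cmat2) ** 0 = 0"
  by (simp_all add: mat2_entries)

lemma degree_less_simps:
  "degree_less P n \<Longrightarrow> degree_less Q n \<Longrightarrow> degree_less (P + Q) n"
  "degree_less P n \<Longrightarrow> degree_less Q n \<Longrightarrow> degree_less (P - Q) n"
  "degree_less P n \<Longrightarrow> degree_less (P ** const_pmat C) n"
  "degree_less P n \<Longrightarrow> degree_less (const_pmat C ** P) n"
  by (simp_all add: degree_less_def coeff_pmat_simps cmat2_mult_0)

lemma degree_less_mono: "degree_less P m \<Longrightarrow> m \<le> n \<Longrightarrow> degree_less P n"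
  by (simp add: degree_less_def)

lemma degree_less_Suc: "degree_less P (Suc n) \<Longrightarrow> coeff_pmat P n = 0 \<Longrightarrow> degree_less P n"
  unfolding degree_less_def by (metis le_antisym not_less_eq_eq)

lemma degree_pmat_le_iff: "degree_pmat P \<le> n \<longleftrightarrow> degree_less P (Suc n)"
proof -
  have deg: "Polynomial.degree p \<le> n \<longleftrightarrow> (\<forall>m\<ge>Suc n. Polynomial.coeff p m = 0)" for p :: "complex poly"
    by (auto simp: coeff_eq_0 Suc_le_eq intro: degree_le)
  have "{Polynomial.degree (P $ i $ j) | i j. True} = (\<lambda>(i,j). Polynomial.degree (P $ i $ j)) ` UNIV"
    by auto
  then have "degree_pmat P \<le> n \<longleftrightarrow> (\<forall>i j. Polynomial.degree (P $ i $ j) \<le> n)"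
    by (auto simp: degree_pmat_def)
  also have "\<dots> \<longleftrightarrow> degree_less P (Suc n)"
    by (auto simp: deg degree_less_def coeff_pmat_def vec_eq_iff)
  finally show ?thesis .
qed

lemma exists_degree_less: "\<exists>n. degree_less P n"
  using degree_pmat_le_iff by blast

lemma coeff_shifted_op:
  "coeff_pmat (weyl_apply (shifted_op r h) P) n =
     mat2 (- r - of_nat n) h (- h) (r + of_nat n) ** coeff_pmat P n
     + mat2 0 (- of_nat (Suc n)) (of_nat (Suc n)) 0 ** coeff_pmat P (Suc n)"
  by (cases n) (simp_all add: shifted_op_def weyl_apply_pCons weyl_apply_0 mat2_entries const_pmat_def
      pderiv_pmat_def coeff_pmat_def coeff_pderiv algebra_simps)

definition scalar_mat2 :: "complex \<Rightarrow> cmat2" where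
  "scalar_mat2 c = mat2 c 0 0 c"

text \<open>
  Both operators act on coefficients by finite recurrences that never involve lower
  coefficients. The diagonal term is a scalar matrix here, which \<open>shifted_op\<close> alone does not
  provide.
\<close>

lemma coeff_jacobi_op:
  "coeff_pmat (weyl_apply (jacobi_op r h) P) n =
     scalar_mat2 ((of_nat n + r)\<^sup>2 - h\<^sup>2) ** coeff_pmat P n
     + (scalar_mat2 (of_nat (Suc n)) ** mat2 (2 * h) (-1) (-1) (2 * h) ** coeff_pmat P (Suc n)
     - scalar_mat2 (of_nat (Suc n * Suc (Suc n))) ** coeff_pmat P (Suc (Suc n)))"
proof -
  consider "n = 0" | "n = 1" | m where "n = Suc (Suc m)"
    by (metis One_nat_def not0_implies_Suc)
  then show ?thesis
    by cases (simp_all add: scalar_mat2_def jacobi_op_def weyl_apply_pCons weyl_apply_0 mat2_entries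
      const_pmat_def pderiv_pmat_def coeff_pmat_def coeff_pderiv algebra_simps power2_eq_square)
qed

section \<open>The operators diagonalised by every orthogonal family form an algebra\<close>

lemma scalar_pmat_commute: "const_pmat (scalar_mat2 c) ** P = P ** const_pmat (scalar_mat2 c)"
  by (simp add: scalar_mat2_def mat2_entries const_pmat_def)

lemma scalar_mat2_commute: "scalar_mat2 c ** A = A ** scalar_mat2 c"
  by (simp add: scalar_mat2_def mat2_entries mult.commute)

lemma const_pmat_mult: "const_pmat (A ** B) = const_pmat A ** const_pmat B"
  by (simp add: mat2_entries const_pmat_def mult.commute)

lemma weyl_apply_add_right: "weyl_apply D (P + Q) = weyl_apply D P + weyl_apply D Q"
proof -
  have "(pderiv_pmat ^^ i) (P + Q) = (pderiv_pmat ^^ i) P + (pderiv_pmat ^^ i) Q" for i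
    by (induction i) (simp_all add: pderiv_pmat_add)
  then show ?thesis by (simp add: weyl_apply_def pmat2_mult_zero_add sum.distrib)
qed

text \<open>
  Operators act from the left, hence they commute with the right multiplication by constant
  matrices. This is why the eigenvalues \<open>\<Lambda>\<close> stand on the right.
\<close>

lemma weyl_apply_mult_const:
  "weyl_apply D (Q ** const_pmat C) = weyl_apply D Q ** const_pmat C"
proof -
  have "(pderiv_pmat ^^ i) (Q ** const_pmat C) = (pderiv_pmat ^^ i) Q ** const_pmat C" for i
    by (induction i) (simp_all add: pderiv_pmat_mult pderiv_pmat_const pmat2_mult_zero_add)
  moreover have "sum f X ** A = (\<Sum>i\<in>X. f i ** A)" for X :: "nat set" and f :: "nat \<Rightarrow> pmat2" and A :: pmat2
    by (induction X rule: infinite_finite_induct) (simp_all add: pmat2_mult_zero_add)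
  ultimately show ?thesis by (simp add: weyl_apply_def matrix_mul_assoc)
qed

lemma weyl_apply_0_right: "weyl_apply D 0 = 0"
  using weyl_apply_add_right[of D 0 0] by simp

text \<open>
  Scalars are treated as scalar matrices, so that the rules for left multiplication by a matrix
  apply.
\<close>

lemma weyl_smult_eq: "weyl_smult c D = map_poly ((**) (const_pmat (scalar_mat2 c))) D"
proof -
  have "smult_pmat c = (**) (const_pmat (scalar_mat2 c))"
    by (simp add: fun_eq_iff smult_pmat_def scalar_mat2_def mat2_entries const_pmat_def)
  then show ?thesis by (simp add: weyl_smult_def)
qed

lemma weyl_apply_smult: "weyl_apply (weyl_smult c D) Q = weyl_apply D Q ** const_pmat (scalar_mat2 c)"
  by (simp add: weyl_smult_eq weyl_apply_left_mult scalar_pmat_commute)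

lemma const_pmat_add: "const_pmat (A + B) = const_pmat A + const_pmat B"
  by (simp add: const_pmat_def vec_eq_iff)

lemma const_pmat_0: "const_pmat 0 = 0"
  by (simp add: const_pmat_def vec_eq_iff)

text \<open>
  The eigenvalue matrices of a family add and multiply along with the operators.
\<close>

lemma diff_op_algebra_subalgebra: "weyl_subalgebra (diff_op_algebra W)"
  unfolding weyl_subalgebra_def diff_op_algebra_def mem_Collect_eq
proof (intro conjI allI ballI impI; (unfold mem_Collect_eq)?; (intro allI impI)?)
  fix Q n show "\<exists>\<Lambda>. weyl_apply 0 (Q n) = Q n ** const_pmat \<Lambda>"
    by (rule exI[of _ 0]) (simp add: weyl_apply_0 const_pmat_0 pmat2_mult_zero_add)
next
  fix c D Q n
  assume "\<forall>Q. matrix_orthogonal_polynomials W Q \<longrightarrow> (\<forall>n. \<exists>\<Lambda>. weyl_apply D (Q n) = Q n ** const_pmat \<Lambda>)"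
    "matrix_orthogonal_polynomials W Q"
  then obtain \<Lambda> where "weyl_apply D (Q n) = Q n ** const_pmat \<Lambda>" by blast
  then show "\<exists>\<Lambda>. weyl_apply (weyl_smult c D) (Q n) = Q n ** const_pmat \<Lambda>"
    by (intro exI[of _ "\<Lambda> ** scalar_mat2 c"])
      (simp add: weyl_apply_smult const_pmat_mult matrix_mul_assoc)
next
  fix D E Q n
  assume *: "\<forall>Q. matrix_orthogonal_polynomials W Q \<longrightarrow> (\<forall>n. \<exists>\<Lambda>. weyl_apply D (Q n) = Q n ** const_pmat \<Lambda>)"
    "\<forall>Q. matrix_orthogonal_polynomials W Q \<longrightarrow> (\<forall>n. \<exists>\<Lambda>. weyl_apply E (Q n) = Q n ** const_pmat \<Lambda>)"
    "matrix_orthogonal_polynomials W Q"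
  then obtain A B where AB: "weyl_apply D (Q n) = Q n ** const_pmat A" "weyl_apply E (Q n) = Q n ** const_pmat B"
    by blast
  show "\<exists>\<Lambda>. weyl_apply (D + E) (Q n) = Q n ** const_pmat \<Lambda>"
    by (rule exI[of _ "A + B"]) (simp add: AB weyl_apply_add const_pmat_add pmat2_mult_zero_add)
  show "\<exists>\<Lambda>. weyl_apply (weyl_mult D E) (Q n) = Q n ** const_pmat \<Lambda>"
    by (rule exI[of _ "A ** B"])
      (simp add: AB weyl_apply_weyl_mult weyl_apply_mult_const const_pmat_mult matrix_mul_assoc)
qed

lemma const_op_1_in_diff_op_algebra: "const_op (mat 1) \<in> diff_op_algebra W"
proof -
  have "weyl_apply (const_op (mat 1)) P = P ** const_pmat (mat 1)" for P
    by (simp add: weyl_apply_const_op mat_def mat2_entries const_pmat_def)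
  then show ?thesis by (auto simp: diff_op_algebra_def)
qed

section \<open>Orthogonal families and eigenpolynomials\<close>

definition monom_pmat :: "nat \<Rightarrow> cmat2 \<Rightarrow> pmat2" where
  "monom_pmat n C = (\<chi> i j. monom (C $ i $ j) n)"

lemma coeff_monom_pmat: "coeff_pmat (monom_pmat n C) m = (if m = n then C else 0)"
  by (simp add: coeff_pmat_def monom_pmat_def vec_eq_iff)

lemma degree_less_split:
  assumes "degree_less Q (Suc n)" and "invertible (coeff_pmat Q n)" and "degree_less P (Suc n)"
  obtains C where "degree_less (P - Q ** const_pmat C) n"
proof -
  from assms(2) obtain B where B: "coeff_pmat Q n ** B = mat 1" by (auto simp: invertible_def)
  let ?C = "B ** coeff_pmat P n"
  have "coeff_pmat (P - Q ** const_pmat ?C) n = 0"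
    by (simp add: coeff_pmat_simps matrix_mul_assoc B)
  then have "degree_less (P - Q ** const_pmat ?C) n"
    using assms by (intro degree_less_Suc[of _ n] degree_less_simps)
  with that show ?thesis .
qed

lemma degree_less_shifted_op: "degree_less P n \<Longrightarrow> degree_less (weyl_apply (shifted_op r h) P) n"
  by (simp add: degree_less_def coeff_shifted_op cmat2_mult_0)

lemma degree_less_jacobi_op: "degree_less P n \<Longrightarrow> degree_less (weyl_apply (jacobi_op r h) P) n"
  by (simp add: degree_less_def coeff_jacobi_op cmat2_mult_0)

text \<open>
  On polynomials of degree less than \<open>n\<close> the operator \<open>J - \<mu>\<^sub>n\<close> is triangular with respect to the
  degree, with nonzero diagonal entries \<open>\<mu>\<^sub>j - \<mu>\<^sub>n\<close>; the equation is solved by eliminating the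
  leading coefficient.
\<close>

lemma jacobi_op_triangular_solve:
  fixes r h :: complex
  assumes "\<And>j. j < n \<Longrightarrow> (of_nat j + r)\<^sup>2 \<noteq> (of_nat n + r)\<^sup>2"
  defines "\<mu> \<equiv> \<lambda>j. (of_nat j + r)\<^sup>2 - h\<^sup>2"
  shows "m \<le> n \<Longrightarrow> degree_less P m \<Longrightarrow>
    \<exists>R. degree_less R m \<and> weyl_apply (jacobi_op r h) R - const_pmat (scalar_mat2 (\<mu> n)) ** R = P"
proof (induction m arbitrary: P)
  case 0
  then show ?case
    by (intro exI[of _ 0]) (simp add: degree_less_0 weyl_apply_0_right pmat2_mult_zero_add)
next
  case (Suc m)
  define T where "T = (\<lambda>R. weyl_apply (jacobi_op r h) R - const_pmat (scalar_mat2 (\<mu> n)) ** R)"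
  \<comment> \<open>The choice of \<open>R\<close> makes the leading coefficients of \<open>T R\<close> and \<open>P\<close> equal.\<close>
  define R where "R = monom_pmat m (scalar_mat2 (1 / (\<mu> m - \<mu> n)) ** coeff_pmat P m)"
  have T_add: "T (P + Q) = T P + T Q" for P Q
    by (simp add: T_def weyl_apply_add_right pmat2_mult_zero_add)
  have "scalar_mat2 a ** (scalar_mat2 (1 / (a - b)) ** X) - scalar_mat2 b ** (scalar_mat2 (1 / (a - b)) ** X) = X"
    if "a \<noteq> b" for a b X
    using that by (simp add: scalar_mat2_def mat2_entries
        flip: diff_divide_distrib left_diff_distrib)
  moreover have "\<mu> m \<noteq> \<mu> n" using assms(1)[of m] Suc.prems by (simp add: \<mu>_def)
  moreover have "coeff_pmat (T R) m = scalar_mat2 (\<mu> m) ** coeff_pmat R m - scalar_mat2 (\<mu> n) ** coeff_pmat R m"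
    by (simp add: T_def R_def coeff_pmat_simps coeff_jacobi_op coeff_monom_pmat cmat2_mult_0 \<mu>_def)
  ultimately have "coeff_pmat (T R) m = coeff_pmat P m"
    by (simp add: R_def coeff_monom_pmat)
  moreover have R: "degree_less R (Suc m)"
    by (simp add: R_def degree_less_def coeff_monom_pmat)
  moreover from R have "degree_less (T R) (Suc m)"
    unfolding T_def by (intro degree_less_simps degree_less_jacobi_op)
  ultimately have "degree_less (P - T R) m"
    using Suc.prems by (intro degree_less_Suc[of _ m]) (simp_all add: degree_less_simps coeff_pmat_simps)
  then obtain R' where R': "degree_less R' m" "T R' = P - T R"
    using Suc.IH Suc.prems unfolding T_def by (meson Suc_leD)
  have "T (R + R') = P"
    using R'(2) by (simp add: T_add)
  moreover have "degree_less (R + R') (Suc m)"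
    using R R' by (intro degree_less_simps) (auto intro: degree_less_mono)
  ultimately show ?case unfolding T_def by blast
qed

text \<open>
  \<open>J - \<mu>\<^sub>n\<close> lowers the degree of \<open>x\<^sup>n I\<close>, and \<open>jacobi_op_triangular_solve\<close> supplies the correction by
  lower-degree terms.
\<close>

lemma jacobi_op_eigenpolynomial:
  assumes "\<And>j. j < n \<Longrightarrow> (of_nat j + r)\<^sup>2 \<noteq> (of_nat n + r)\<^sup>2"
  shows "\<exists>Q. degree_less Q (Suc n) \<and> coeff_pmat Q n = mat 1 \<and>
    weyl_apply (jacobi_op r h) Q = Q ** const_pmat (scalar_mat2 ((of_nat n + r)\<^sup>2 - h\<^sup>2))"
proof -
  define T where "T = (\<lambda>R. weyl_apply (jacobi_op r h) R - const_pmat (scalar_mat2 ((of_nat n + r)\<^sup>2 - h\<^sup>2)) ** R)"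
  define X where "X = monom_pmat n (mat 1)"
  have X: "degree_less X (Suc n)" "coeff_pmat X n = mat 1"
    by (simp_all add: X_def degree_less_def coeff_monom_pmat)
  have "coeff_pmat (T X) n = 0"
    by (simp add: T_def X_def coeff_pmat_simps coeff_jacobi_op coeff_monom_pmat cmat2_mult_0)
  then have "degree_less (T X) n"
    using X by (intro degree_less_Suc[of _ n]) (simp_all add: T_def degree_less_simps degree_less_jacobi_op)
  then obtain R where R: "degree_less R n" "T R = T X"
    using jacobi_op_triangular_solve[OF assms, where m = n and P = "T X"] unfolding T_def by auto
  have "T (P + Q) = T P + T Q" for P Q
    by (simp add: T_def weyl_apply_add_right pmat2_mult_zero_add)
  from this[of R "X - R"] have "T X = T R + T (X - R)" by simp
  then have "T (X - R) = 0" using R by simp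
  moreover have "degree_less (X - R) (Suc n)"
    using X R by (intro degree_less_simps) (auto intro: degree_less_mono)
  moreover have "coeff_pmat (X - R) n = mat 1"
    using X R by (simp add: coeff_pmat_simps degree_less_def)
  ultimately show ?thesis
    by (intro exI[of _ "X - R"]) (simp add: T_def scalar_pmat_commute)
qed

context
  fixes k1 k2 :: real
  assumes k1: "k1 \<ge> 0" and k2: "k2 \<ge> 0"
begin

text \<open>
  The invertible leading coefficient forces the degree to be exactly \<open>n\<close>, so an upper bound is
  enough.
\<close>

lemma matrix_orthogonal_polynomials_iff:
  "matrix_orthogonal_polynomials (weight k1 k2) Q \<longleftrightarrow>
     (\<forall>n. degree_less (Q n) (Suc n) \<and> invertible (coeff_pmat (Q n) n)) \<and>
     (\<forall>n m. n \<noteq> m \<longrightarrow> inner_pmat k1 k2 (Q n) (Q m) = 0)"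
proof -
  have "degree_pmat P = n" if "degree_less P (Suc n)" "invertible (coeff_pmat P n)" for P n
  proof (rule antisym)
    show "degree_pmat P \<le> n" using that by (simp add: degree_pmat_le_iff)
    have "coeff_pmat P n \<noteq> 0"
    proof
      assume "coeff_pmat P n = 0"
      then have "(mat 1 :: cmat2) = 0" using that(2) by (auto simp: invertible_def cmat2_mult_0)
      then show False by (simp add: mat_def vec_eq_iff forall_2)
    qed
    moreover have "degree_less P (Suc (degree_pmat P))" by (simp flip: degree_pmat_le_iff)
    ultimately show "n \<le> degree_pmat P"
      by (meson degree_less_def not_less_eq_eq)
  qed
  moreover have "degree_less P (Suc n)" if "degree_pmat P = n" for P n
    using that by (simp flip: degree_pmat_le_iff)
  ultimately show ?thesis
    unfolding matrix_orthogonal_polynomials_def LINT_eval_gram[OF k1 k2] by blast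
qed

lemma orthogonal_to_lower_degree:
  assumes Q: "matrix_orthogonal_polynomials (weight k1 k2) Q"
  shows "degree_less P m \<Longrightarrow> m \<le> n \<Longrightarrow> inner_pmat k1 k2 P (Q n) = 0"
proof (induction m arbitrary: P)
  case 0
  then show ?case by (simp add: degree_less_0 inner_0[OF k1 k2])
next
  case (Suc m)
  from Q Suc.prems obtain C where C: "degree_less (P - Q m ** const_pmat C) m"
    unfolding matrix_orthogonal_polynomials_iff by (metis degree_less_split)
  have "inner_pmat k1 k2 (Q m) (Q n) = 0"
    using Q Suc.prems unfolding matrix_orthogonal_polynomials_iff by auto
  moreover have "inner_pmat k1 k2 (P - Q m ** const_pmat C) (Q n) = 0"
    using C Suc by auto
  moreover have "P = (P - Q m ** const_pmat C) + Q m ** const_pmat C" by simp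
  ultimately show ?case
    by (metis inner_add_left[OF k1 k2] inner_const_left[OF k1 k2] cmat2_mult_0(2) add_0)
qed

text \<open>
  Subtract \<open>Q\<^sub>n C\<close> from \<open>D Q\<^sub>n\<close> so that the rest \<open>R\<close> has degree less than \<open>n\<close>. Then \<open>R\<close> is orthogonal
  to \<open>Q\<^sub>n\<close>, and \<open>\<langle>R, D Q\<^sub>n\<rangle> = \<langle>D R, Q\<^sub>n\<rangle> = 0\<close> because \<open>D R\<close> also has degree less than \<open>n\<close>. Hence
  \<open>\<langle>R, R\<rangle> = 0\<close>.
\<close>

lemma symmetric_op_in_diff_op_algebra:
  assumes sym: "\<And>P Q. inner_pmat k1 k2 (weyl_apply D P) Q = inner_pmat k1 k2 P (weyl_apply D Q)"
    and deg: "\<And>P n. degree_less P n \<Longrightarrow> degree_less (weyl_apply D P) n"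
  shows "D \<in> diff_op_algebra (weight k1 k2)"
  unfolding diff_op_algebra_def mem_Collect_eq
proof (intro allI impI)
  fix Q n
  assume Q: "matrix_orthogonal_polynomials (weight k1 k2) Q"
  note lower = orthogonal_to_lower_degree[OF Q _ order.refl]
  from Q obtain C where C: "degree_less (weyl_apply D (Q n) - Q n ** const_pmat C) n"
    unfolding matrix_orthogonal_polynomials_iff by (metis deg degree_less_split)
  define R where "R = weyl_apply D (Q n) - Q n ** const_pmat C"
  have eq: "weyl_apply D (Q n) = R + Q n ** const_pmat C" by (simp add: R_def)
  have "0 = inner_pmat k1 k2 (weyl_apply D R) (Q n)"
    using C by (intro lower[symmetric] deg) (simp add: R_def)
  also have "\<dots> = inner_pmat k1 k2 R R + inner_pmat k1 k2 R (Q n) ** C"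
    by (simp add: sym eq inner_add_right[OF k1 k2] inner_const_right[OF k1 k2])
  also have "inner_pmat k1 k2 R (Q n) = 0"
    using C by (intro lower) (simp add: R_def)
  finally have "R = 0"
    by (intro inner_definite[OF k1 k2]) (simp add: cmat2_mult_0)
  with eq show "\<exists>\<Lambda>. weyl_apply D (Q n) = Q n ** const_pmat \<Lambda>" by auto
qed

lemma S_op_in_diff_op_algebra: "S_op \<in> diff_op_algebra (weight k1 k2)"
  by (rule symmetric_op_in_diff_op_algebra)
    (simp_all add: swap_symmetric, simp add: S_op_def weyl_apply_const_op degree_less_simps)

lemma shifted_op_in_diff_op_algebra:
  "shifted_op (of_real (rho k1 k2 + 1 / 2)) (of_real (k1 / 2)) \<in> diff_op_algebra (weight k1 k2)"
  by (rule symmetric_op_in_diff_op_algebra)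
    (use shifted_op_symmetric[OF k1 k2] degree_less_shifted_op in auto)

lemma jacobi_eigenvalues_distinct:
  fixes m n :: nat
  assumes "m \<noteq> n"
  shows "(of_nat m + complex_of_real (rho k1 k2 + 1 / 2))\<^sup>2 \<noteq> (of_nat n + complex_of_real (rho k1 k2 + 1 / 2))\<^sup>2"
proof -
  have r: "rho k1 k2 + 1 / 2 > 0" using k1 k2 by (simp add: rho_def add_nonneg_pos)
  have "(real m + (rho k1 k2 + 1 / 2))\<^sup>2 \<noteq> (real n + (rho k1 k2 + 1 / 2))\<^sup>2"
    using assms r by (subst power2_eq_iff_nonneg) auto
  then have "complex_of_real ((real m + (rho k1 k2 + 1 / 2))\<^sup>2) \<noteq> complex_of_real ((real n + (rho k1 k2 + 1 / 2))\<^sup>2)"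
    using of_real_eq_iff by blast
  then show ?thesis by simp
qed

text \<open>
  The eigenvalues are real, distinct and scalar, and the operator is symmetric; so the usual
  argument for eigenvectors of a symmetric operator gives orthogonality.
\<close>

lemma orthogonal_eigenfamily:
  obtains Q where "matrix_orthogonal_polynomials (weight k1 k2) Q"
    and "\<And>n. weyl_apply (jacobi_op (of_real (rho k1 k2 + 1 / 2)) (of_real (k1 / 2))) (Q n) =
      Q n ** const_pmat (scalar_mat2 ((of_nat n + of_real (rho k1 k2 + 1 / 2))\<^sup>2 - (of_real (k1 / 2))\<^sup>2))"
proof -
  define r h where "r = complex_of_real (rho k1 k2 + 1 / 2)" and "h = complex_of_real (k1 / 2)"
  define \<mu> where "\<mu> = (\<lambda>n::nat. (of_nat n + r)\<^sup>2 - h\<^sup>2)"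
  have "\<exists>Q. degree_less Q (Suc n) \<and> coeff_pmat Q n = mat 1 \<and>
      weyl_apply (jacobi_op r h) Q = Q ** const_pmat (scalar_mat2 (\<mu> n))" for n
    unfolding \<mu>_def r_def
    by (intro jacobi_op_eigenpolynomial jacobi_eigenvalues_distinct) auto
  then obtain Q where Q: "\<And>n. degree_less (Q n) (Suc n)" "\<And>n. coeff_pmat (Q n) n = mat 1"
    "\<And>n. weyl_apply (jacobi_op r h) (Q n) = Q n ** const_pmat (scalar_mat2 (\<mu> n))"
    by metis
  have "inner_pmat k1 k2 (Q n) (Q m) = 0" if "n \<noteq> m" for n m
  proof -
    let ?G = "inner_pmat k1 k2 (Q n) (Q m)"
    have real: "cnj (\<mu> n) = \<mu> n" by (simp add: \<mu>_def r_def h_def)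
    have "inner_pmat k1 k2 (weyl_apply (jacobi_op r h) (Q n)) (Q m) =
        inner_pmat k1 k2 (Q n) (weyl_apply (jacobi_op r h) (Q m))"
      using shifted_op_symmetric[OF k1 k2] by (simp add: r_def h_def flip: shifted_op_square)
    then have "conj_transpose (scalar_mat2 (\<mu> n)) ** ?G = ?G ** scalar_mat2 (\<mu> m)"
      by (simp add: Q inner_const_left[OF k1 k2] inner_const_right[OF k1 k2])
    then have "\<mu> n * ?G $ i $ j = \<mu> m * ?G $ i $ j" for i j
      using exhaust_2[of i] exhaust_2[of j] by (auto simp: conj_transpose_def scalar_mat2_def mat2_entries real)
    moreover have "\<mu> n \<noteq> \<mu> m"
      using jacobi_eigenvalues_distinct[OF that] by (simp add: \<mu>_def r_def)
    ultimately show ?thesis by (simp add: vec_eq_iff)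
  qed
  moreover have "invertible (mat 1 :: cmat2)" by (auto simp: invertible_def intro!: exI[of _ "mat 1"])
  ultimately have "matrix_orthogonal_polynomials (weight k1 k2) Q"
    unfolding matrix_orthogonal_polynomials_iff by (simp add: Q)
  with Q(3) show ?thesis using that unfolding \<mu>_def r_def h_def by blast
qed

end

section \<open>Coefficients of products in the Weyl algebra\<close>

lemma pderiv_pmat_monom_Suc:
  "pderiv_pmat (monom_pmat (Suc n) C) = monom_pmat n (scalar_mat2 (of_nat (Suc n)) ** C)"
  by (simp add: pderiv_pmat_def monom_pmat_def scalar_mat2_def mat2_entries pderiv_monom)

lemma scalar_mat2_mult: "scalar_mat2 a ** (scalar_mat2 b ** C) = scalar_mat2 (a * b) ** C"
  by (simp add: scalar_mat2_def mat2_entries)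

lemma iterated_pderiv_monom_pmat:
  "(pderiv_pmat ^^ n) (monom_pmat n C) = const_pmat (scalar_mat2 (fact n) ** C)"
proof (induction n arbitrary: C)
  case 0
  show ?case by (simp add: monom_pmat_def const_pmat_def scalar_mat2_def mat2_entries monom_0)
next
  case (Suc n)
  show ?case
    by (simp add: funpow_Suc_right pderiv_pmat_monom_Suc Suc.IH scalar_mat2_mult mult.commute
        del: funpow.simps)
qed

text \<open>
  Applied to \<open>x\<^sup>i I\<close>, an operator whose coefficients of order less than \<open>i\<close> vanish returns \<open>i!\<close>
  times its coefficient of order \<open>i\<close>. So all coefficients of an operator that acts as zero vanish,
  one after the other.
\<close>

lemma weyl_op_eq_0I:
  assumes zero: "\<And>Q. weyl_apply D Q = 0"
  shows "D = 0"
proof (rule poly_eqI)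
  fix i
  show "Polynomial.coeff D i = Polynomial.coeff 0 i"
  proof (induction i rule: less_induct)
    case (less i)
    let ?M = "monom_pmat i (mat 1)"
    have "(pderiv_pmat ^^ (Suc i)) ?M = 0"
      by (simp add: iterated_pderiv_monom_pmat pderiv_pmat_const)
    then have "(pderiv_pmat ^^ j) ?M = 0" if "j > i" for j
    proof (rule dec_induct[OF Suc_leI[OF that]])
    qed (simp_all add: pderiv_pmat_0)
    then have "Polynomial.coeff D j ** (pderiv_pmat ^^ j) ?M =
        (if j = i then Polynomial.coeff D i ** const_pmat (scalar_mat2 (fact i)) else 0)" for j
      using less by (cases j i rule: linorder_cases)
        (auto simp: iterated_pderiv_monom_pmat pmat2_mult_zero_add)
    moreover have "0 = (\<Sum>j\<le>max i (Polynomial.degree D). Polynomial.coeff D j ** (pderiv_pmat ^^ j) ?M)"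
      using zero[of ?M] by (simp add: weyl_apply_bound[where n = "max i (Polynomial.degree D)"])
    ultimately have "Polynomial.coeff D i ** const_pmat (scalar_mat2 (fact i)) = 0" by simp
    then show ?case
      by (simp add: scalar_mat2_def mat2_entries const_pmat_def)
  qed
qed

lemma weyl_op_eqI:
  assumes "\<And>Q. weyl_apply D Q = weyl_apply E Q"
  shows "D = E"
proof -
  have "weyl_apply (D - E) Q = 0" for Q
    using weyl_apply_add[of "D - E" E Q] assms[of Q] by simp
  then show ?thesis using weyl_op_eq_0I[of "D - E"] by simp
qed

lemma coeff_partial_mult:
  "Polynomial.coeff (partial_mult E) m = Polynomial.coeff (pCons 0 E) m + pderiv_pmat (Polynomial.coeff E m)"
  by (simp add: partial_mult_def coeff_map_poly pderiv_pmat_0)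

lemma coeff_weyl_mult:
  assumes "Polynomial.degree D \<le> n"
  shows "Polynomial.coeff (weyl_mult D E) m =
    (\<Sum>i\<le>n. Polynomial.coeff D i ** Polynomial.coeff ((partial_mult ^^ i) E) m)"
proof -
  have "Polynomial.coeff (weyl_mult D E) m =
    (\<Sum>i\<le>Polynomial.degree D. Polynomial.coeff D i ** Polynomial.coeff ((partial_mult ^^ i) E) m)"
    by (simp add: weyl_mult_def coeff_sum coeff_map_poly pmat2_mult_zero_add)
  also have "\<dots> = (\<Sum>i\<le>n. Polynomial.coeff D i ** Polynomial.coeff ((partial_mult ^^ i) E) m)"
    by (rule sum.mono_neutral_left)
      (use assms in \<open>auto simp: not_le Polynomial.coeff_eq_0 pmat2_mult_zero_add\<close>)
  finally show ?thesis .
qed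

text \<open>
  The Leibniz rule for \<open>\<partial>\<^sup>i (B \<partial>\<^sup>2 + T \<partial> + C)\<close>, as far as the two highest orders are concerned:
  \<open>B \<partial>\<^sup>i\<^sup>+\<^sup>2 + (T + i B') \<partial>\<^sup>i\<^sup>+\<^sup>1\<close>.
\<close>

lemma coeff_partial_mult_power_quadratic:
  fixes C T B :: pmat2
  defines "J \<equiv> [: C, T, B :]"
  shows "m > i + 2 \<Longrightarrow> Polynomial.coeff ((partial_mult ^^ i) J) m = 0"
    and "Polynomial.coeff ((partial_mult ^^ i) J) (i + 2) = B"
    and "Polynomial.coeff ((partial_mult ^^ i) J) (i + 1) = T + smult_pmat (of_nat i) (pderiv_pmat B)"
proof (induction i arbitrary: m)
  case 0
  { case 1 then show ?case by (auto simp: J_def coeff_pCons split: nat.splits)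
  next case 2 then show ?case by (simp add: J_def numeral_2_eq_2)
  next case 3 then show ?case by (simp add: J_def smult_pmat_def vec_eq_iff) }
next
  case (Suc i)
  { case 1 then show ?case using Suc(1)[of m] Suc(1)[of "m - 1"]
      by (cases m) (simp_all add: coeff_partial_mult pderiv_pmat_0)
  next case 2 then show ?case using Suc(1)[of "i + 3"] Suc(2)
      by (simp add: coeff_partial_mult pderiv_pmat_0 numeral_3_eq_3)
  next case 3 then show ?case using Suc(2,3)
      by (simp add: coeff_partial_mult) (simp add: smult_pmat_def vec_eq_iff smult_add_left) }
qed

section \<open>Leading coefficients of operators that commute with the Jacobi operator\<close>

text \<open>
  The leading coefficient of \<open>\<D>\<^sub>k\<close>. Its powers are the leading coefficients of the powers of \<open>\<D>\<^sub>k\<close>;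
  they are taken with respect to the matrix product, while \<open>^\<close> on this type would multiply entry
  by entry.
\<close>

definition symbol_base :: pmat2 where
  "symbol_base = mat2 (- [:0, 1:]) (-1) 1 [:0, 1:]"

definition symbol_power :: "nat \<Rightarrow> pmat2" where
  "symbol_power n = (((**) symbol_base) ^^ n) (mat 1)"

text \<open>
  This compares the coefficients of order \<open>n + 1\<close> of the two products. Those of order \<open>n + 2\<close> agree
  because \<open>s I\<close> is scalar. For the same reason the coefficient of order \<open>n - 1\<close> of \<open>D\<close> cancels here,
  so that an equation for the leading coefficient alone is left.
\<close>

lemma leading_coeff_equation:
  fixes C T :: pmat2 and s :: "complex poly"
  assumes deg: "Polynomial.degree D \<le> n"
    and comm: "weyl_mult D [: C, T, mat2 s 0 0 s :] = weyl_mult [: C, T, mat2 s 0 0 s :] D"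
  defines "A \<equiv> Polynomial.coeff D n"
  shows "2 * s * pderiv (A $ i $ j) + (T ** A) $ i $ j = (A ** T) $ i $ j + of_nat n * pderiv s * A $ i $ j"
proof -
  let ?B = "mat2 s 0 0 s" and ?J = "[: C, T, mat2 s 0 0 s :]"
  let ?L = "Polynomial.coeff (pCons 0 D) n"
  have D0: "Polynomial.coeff D m = 0" if "m > n" for m
    using that deg by (simp add: coeff_eq_0)
  note J = coeff_partial_mult_power_quadratic[where C = C and T = T and B = ?B]
  have "Polynomial.coeff (weyl_mult D ?J) (Suc n) = ?L ** ?B + A ** (T + smult_pmat (of_nat n) (pderiv_pmat ?B))"
  proof (cases n)
    case 0
    then show ?thesis
      using J(3)[of 0] by (simp add: coeff_weyl_mult[OF deg] A_def pmat2_mult_zero_add)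
  next
    case (Suc k)
    have "(\<Sum>i\<le>k. Polynomial.coeff D i ** Polynomial.coeff ((partial_mult ^^ i) ?J) (Suc n)) =
      (\<Sum>i\<le>k. if i = k then Polynomial.coeff D k ** ?B else 0)"
      using J(1,2) Suc by (intro sum.cong) (auto simp: pmat2_mult_zero_add)
    then show ?thesis
      using J(3)[of n] Suc by (simp add: coeff_weyl_mult[OF deg] A_def del: funpow.simps)
  qed
  moreover have "Polynomial.coeff (weyl_mult ?J D) (Suc n) = T ** A + ?B ** (?L + pderiv_pmat A + pderiv_pmat A)"
  proof -
    have "Polynomial.degree ?J \<le> 2" by simp
    then show ?thesis
      by (simp add: coeff_weyl_mult numeral_2_eq_2 coeff_partial_mult D0 pderiv_pmat_0 A_def
          pmat2_mult_zero_add)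
  qed
  ultimately have "(?L ** ?B + A ** (T + smult_pmat (of_nat n) (pderiv_pmat ?B))) $ i $ j =
      (T ** A + ?B ** (?L + pderiv_pmat A + pderiv_pmat A)) $ i $ j"
    using comm by metis
  moreover have "(P ** ?B) $ i $ j = s * P $ i $ j" "(?B ** P) $ i $ j = s * P $ i $ j" for P
    using exhaust_2[of i] exhaust_2[of j] by (auto simp: mat2_entries)
  moreover have "(A ** smult_pmat (of_nat n) (pderiv_pmat ?B)) $ i $ j = of_nat n * pderiv s * A $ i $ j"
    using exhaust_2[of i] exhaust_2[of j]
    by (auto simp: mat2_entries smult_pmat_def pderiv_pmat_def of_nat_poly mult.commute)
  ultimately show ?thesis
    by (simp add: pmat2_mult_zero_add pderiv_pmat_def algebra_simps)
qed

text \<open>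
  Away from \<open>\<plusminus>1\<close> the solutions of the equation are the multiples of \<open>(1 - x)\<^sup>a (1 + x)\<^sup>b\<close>, which are
  polynomials only for natural exponents. The algebraic argument divides by a linear factor
  at a root \<open>1\<close> or \<open>-1\<close>, which lowers \<open>a\<close> or \<open>b\<close> by one. If neither point is a root, evaluation of
  the equation there gives \<open>a = b = 0\<close>, and \<open>f\<close> is constant.
\<close>

lemma first_order_ode_polynomial:
  fixes f :: "complex poly"
  assumes "(1 - [:0,1:]\<^sup>2) * pderiv f = (Polynomial.smult b (1 - [:0,1:]) - Polynomial.smult a (1 + [:0,1:])) * f"
  shows "f = 0 \<or> (\<exists>s t c. a = of_nat s \<and> b = of_nat t \<and> f = Polynomial.smult c ([:-1,1:] ^ s * [:1,1:] ^ t))"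
  using assms
proof (induction "Polynomial.degree f" arbitrary: f a b rule: less_induct)
  case less
  have eval: "(1 - x\<^sup>2) * poly (pderiv f) x = (b * (1 - x) - a * (1 + x)) * poly f x" for x
    using arg_cong[OF less.prems, of "\<lambda>p. poly p x"] by simp
  consider "f = 0" | "f \<noteq> 0" "poly f 1 = 0" | "f \<noteq> 0" "poly f (-1) = 0"
    | "f \<noteq> 0" "poly f 1 \<noteq> 0" "poly f (-1) \<noteq> 0" by blast
  then show ?case
  proof cases
    case 1 then show ?thesis by simp
  next
    case 2
    then obtain g where g: "f = [:-1,1:] * g" by (auto simp: poly_eq_0_iff_dvd elim: dvdE)
    with 2 have "g \<noteq> 0" by auto
    then have "Polynomial.degree g < Polynomial.degree f" using g by (simp add: degree_mult_eq del: mult_pCons_left)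
    moreover have "[:-1,1:] * ((1 - [:0,1:]\<^sup>2) * pderiv g) =
        [:-1,1:] * ((Polynomial.smult b (1 - [:0,1:]) - Polynomial.smult (a - 1) (1 + [:0,1:])) * g)"
    proof (rule poly_ext)
      fix x
      show "poly ([:-1,1:] * ((1 - [:0,1:]\<^sup>2) * pderiv g)) x =
        poly ([:-1,1:] * ((Polynomial.smult b (1 - [:0,1:]) - Polynomial.smult (a - 1) (1 + [:0,1:])) * g)) x"
      proof -
        have "(1 - x\<^sup>2) * ((x - 1) * poly (pderiv g) x + poly g x)
            = (b * (1 - x) - a * (1 + x)) * ((x - 1) * poly g x)"
          using eval[of x] unfolding g by (simp add: pderiv_mult pderiv_pCons del: mult_pCons_left)
        moreover have "(x - 1) * ((1 - x\<^sup>2) * poly (pderiv g) x) =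
            (1 - x\<^sup>2) * ((x - 1) * poly (pderiv g) x + poly g x) - (1 - x\<^sup>2) * poly g x"
          by (simp add: algebra_simps)
        moreover have "(x - 1) * ((b * (1 - x) - (a - 1) * (1 + x)) * poly g x) =
            (b * (1 - x) - a * (1 + x)) * ((x - 1) * poly g x) - (1 - x\<^sup>2) * poly g x"
          by (simp add: algebra_simps power2_eq_square)
        ultimately have "(x - 1) * ((1 - x\<^sup>2) * poly (pderiv g) x) =
            (x - 1) * ((b * (1 - x) - (a - 1) * (1 + x)) * poly g x)"
          by (simp only:)
        then show ?thesis by (simp add: algebra_simps)
      qed
    qed
    then have "(1 - [:0,1:]\<^sup>2) * pderiv g =
        (Polynomial.smult b (1 - [:0,1:]) - Polynomial.smult (a - 1) (1 + [:0,1:])) * g"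
      by (subst (asm) mult_cancel_left) simp
    ultimately obtain s t c where "a - 1 = of_nat s" "b = of_nat t" "g = Polynomial.smult c ([:-1,1:] ^ s * [:1,1:] ^ t)"
      using less.hyps \<open>g \<noteq> 0\<close> by blast
    then show ?thesis
      by (intro disjI2 exI[of _ "Suc s"] exI[of _ t] exI[of _ c]) (simp add: g algebra_simps del: mult_pCons_left)
  next
    case 3
    then obtain g where g: "f = [:1,1:] * g" by (auto simp: poly_eq_0_iff_dvd elim: dvdE)
    with 3 have "g \<noteq> 0" by auto
    then have "Polynomial.degree g < Polynomial.degree f" using g by (simp add: degree_mult_eq del: mult_pCons_left)
    moreover have "[:1,1:] * ((1 - [:0,1:]\<^sup>2) * pderiv g) =
        [:1,1:] * ((Polynomial.smult (b - 1) (1 - [:0,1:]) - Polynomial.smult a (1 + [:0,1:])) * g)"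
    proof (rule poly_ext)
      fix x
      show "poly ([:1,1:] * ((1 - [:0,1:]\<^sup>2) * pderiv g)) x =
        poly ([:1,1:] * ((Polynomial.smult (b - 1) (1 - [:0,1:]) - Polynomial.smult a (1 + [:0,1:])) * g)) x"
      proof -
        have "(1 - x\<^sup>2) * ((1 + x) * poly (pderiv g) x + poly g x)
            = (b * (1 - x) - a * (1 + x)) * ((1 + x) * poly g x)"
          using eval[of x] unfolding g by (simp add: pderiv_mult pderiv_pCons del: mult_pCons_left)
        moreover have "(1 + x) * ((1 - x\<^sup>2) * poly (pderiv g) x) =
            (1 - x\<^sup>2) * ((1 + x) * poly (pderiv g) x + poly g x) - (1 - x\<^sup>2) * poly g x"
          by (simp add: algebra_simps)
        moreover have "(1 + x) * (((b - 1) * (1 - x) - a * (1 + x)) * poly g x) =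
            (b * (1 - x) - a * (1 + x)) * ((1 + x) * poly g x) - (1 - x\<^sup>2) * poly g x"
          by (simp add: algebra_simps power2_eq_square)
        ultimately have "(1 + x) * ((1 - x\<^sup>2) * poly (pderiv g) x) =
            (1 + x) * (((b - 1) * (1 - x) - a * (1 + x)) * poly g x)"
          by (simp only:)
        then show ?thesis by (simp add: algebra_simps)
      qed
    qed
    then have "(1 - [:0,1:]\<^sup>2) * pderiv g =
        (Polynomial.smult (b - 1) (1 - [:0,1:]) - Polynomial.smult a (1 + [:0,1:])) * g"
      by (subst (asm) mult_cancel_left) simp
    ultimately obtain s t c where "a = of_nat s" "b - 1 = of_nat t" "g = Polynomial.smult c ([:-1,1:] ^ s * [:1,1:] ^ t)"
      using less.hyps \<open>g \<noteq> 0\<close> by blast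
    then show ?thesis
      by (intro disjI2 exI[of _ s] exI[of _ "Suc t"] exI[of _ c]) (simp add: g algebra_simps del: mult_pCons_left)
  next
    case 4
    then have ab: "a = 0" "b = 0" using eval[of 1] eval[of "-1"] by simp_all
    have "poly (1 - [:0,1:]\<^sup>2) 2 \<noteq> (0::complex)" by simp
    then have "1 - [:0,1:]\<^sup>2 \<noteq> (0::complex poly)" by (metis poly_0)
    with less.prems ab have "pderiv f = 0" by simp
    then obtain c where "f = [:c:]" by (metis pderiv_iszero)
    then show ?thesis using ab by (intro disjI2 exI[of _ 0] exI[of _ c]) simp
  qed
qed

lemma symbol_base_square: "symbol_base ** symbol_base = mat2 [:-1,0,1:] 0 0 [:-1,0,1:]"
  by (simp add: symbol_base_def mat2_entries one_pCons)

lemma symbol_power_even: "symbol_power (2 * m) = mat2 ([:-1,0,1:] ^ m) 0 0 ([:-1,0,1:] ^ m)"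
proof (induction m)
  case 0
  show ?case by (simp add: symbol_power_def mat_def mat2_entries)
next
  case (Suc m)
  then show ?case
    by (simp add: symbol_power_def matrix_mul_assoc symbol_base_square) (simp add: mat2_entries)
qed

lemma symbol_power_odd:
  "symbol_power (Suc (2 * m)) = symbol_base ** mat2 ([:-1,0,1:] ^ m) 0 0 ([:-1,0,1:] ^ m)"
  using symbol_power_even[of m] by (simp add: symbol_power_def)

text \<open>
  \<open>\<ell>\<close> is not a zero divisor because \<open>\<ell>\<^sup>2\<close> is the nonzero scalar \<open>x\<^sup>2 - 1\<close>.
\<close>

lemma symbol_power_cancel:
  assumes "P ** symbol_power n = 0"
  shows "P = 0"
  using assms
proof (induction n arbitrary: P)
  case 0
  then show ?case by (simp add: symbol_power_def)
next
  case (Suc n)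
  then have "(P ** symbol_base) ** symbol_power n = 0"
    by (simp add: symbol_power_def matrix_mul_assoc)
  then have "P ** symbol_base = 0" by (rule Suc.IH)
  then have "P ** mat2 [:-1,0,1:] 0 0 [:-1,0,1:] = 0"
    by (simp add: pmat2_mult_zero_add matrix_mul_assoc flip: symbol_base_square)
  then show ?case by (simp add: mat2_entries del: mult_pCons_left mult_pCons_right)
qed

text \<open>
  The hypotheses are the four entries of \<open>leading_coeff_equation\<close> for \<open>jacobi_op\<close> at a point \<open>x\<close>.
  Conjugation by \<open>S\<close> splits a matrix with rows \<open>(a, b)\<close> and \<open>(c, d)\<close> into a part that commutes with
  \<open>S\<close>, given by \<open>a + d\<close> and \<open>b + c\<close>, and a part that anticommutes with \<open>S\<close>, given by \<open>a - d\<close> and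
  \<open>b - c\<close>. The commutator with \<open>T\<close> vanishes on the former and exchanges the two coordinates of
  the latter, so their sum and difference decouple.
\<close>

lemma odes_of_entries:
  fixes x t n a b c d a' b' c' d' :: complex
  assumes "2 * (x\<^sup>2 - 1) * a' + (t * a - c) = (a * t - b) + n * (2 * x) * a"
    and "2 * (x\<^sup>2 - 1) * b' + (t * b - d) = (b * t - a) + n * (2 * x) * b"
    and "2 * (x\<^sup>2 - 1) * c' + (t * c - a) = (c * t - d) + n * (2 * x) * c"
    and "2 * (x\<^sup>2 - 1) * d' + (t * d - b) = (d * t - c) + n * (2 * x) * d"
  shows "(1 - x\<^sup>2) * (a' + d') = (n / 2 * (1 - x) - n / 2 * (1 + x)) * (a + d)"
    and "(1 - x\<^sup>2) * (b' + c') = (n / 2 * (1 - x) - n / 2 * (1 + x)) * (b + c)"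
    and "(1 - x\<^sup>2) * (a' - d' + (b' - c')) = ((n + 1) / 2 * (1 - x) - (n - 1) / 2 * (1 + x)) * (a - d + (b - c))"
    and "(1 - x\<^sup>2) * (a' - d' - (b' - c')) = ((n - 1) / 2 * (1 - x) - (n + 1) / 2 * (1 + x)) * (a - d - (b - c))"
proof -
  have *: "2 * ((1 - x\<^sup>2) * y) = - (2 * (x\<^sup>2 - 1) * y)" for y by (simp add: algebra_simps)
  have e: "2 * (x\<^sup>2 - 1) * a' = c - b + n * (2 * x) * a" "2 * (x\<^sup>2 - 1) * b' = d - a + n * (2 * x) * b"
    "2 * (x\<^sup>2 - 1) * c' = a - d + n * (2 * x) * c" "2 * (x\<^sup>2 - 1) * d' = b - c + n * (2 * x) * d"
    using assms by (simp_all add: algebra_simps)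
  have "y = z" if "2 * y = 2 * z" for y z :: complex using that by simp
  note half = this
  show "(1 - x\<^sup>2) * (a' + d') = (n / 2 * (1 - x) - n / 2 * (1 + x)) * (a + d)"
    by (rule half, subst *, simp only: distrib_left[of "2 * (x\<^sup>2 - 1)"] right_diff_distrib[of "2 * (x\<^sup>2 - 1)"] e) (simp add: field_simps)
  show "(1 - x\<^sup>2) * (b' + c') = (n / 2 * (1 - x) - n / 2 * (1 + x)) * (b + c)"
    by (rule half, subst *, simp only: distrib_left[of "2 * (x\<^sup>2 - 1)"] right_diff_distrib[of "2 * (x\<^sup>2 - 1)"] e) (simp add: field_simps)
  show "(1 - x\<^sup>2) * (a' - d' + (b' - c')) = ((n + 1) / 2 * (1 - x) - (n - 1) / 2 * (1 + x)) * (a - d + (b - c))"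
    by (rule half, subst *, simp only: distrib_left[of "2 * (x\<^sup>2 - 1)"] right_diff_distrib[of "2 * (x\<^sup>2 - 1)"] e) (simp add: field_simps)
  show "(1 - x\<^sup>2) * (a' - d' - (b' - c')) = ((n - 1) / 2 * (1 - x) - (n + 1) / 2 * (1 + x)) * (a - d - (b - c))"
    by (rule half, subst *, simp only: distrib_left[of "2 * (x\<^sup>2 - 1)"] right_diff_distrib[of "2 * (x\<^sup>2 - 1)"] e) (simp add: field_simps)
qed

text \<open>
  The exponents required by \<open>first_order_ode_polynomial\<close> are \<open>n/2\<close> for the part that commutes with
  \<open>S\<close> and \<open>(n \<plusminus> 1)/2\<close> for the part that anticommutes with it. So the latter vanishes for even \<open>n\<close> and the
  former for odd \<open>n\<close>; the two constants that remain are \<open>\<alpha>\<close> and \<open>\<beta>\<close> up to a linear change.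
\<close>

lemma commuting_leading_coeff:
  assumes deg: "Polynomial.degree D \<le> n"
    and comm: "weyl_mult D (jacobi_op r h) = weyl_mult (jacobi_op r h) D"
  shows "\<exists>\<alpha> \<beta>. Polynomial.coeff D n = const_pmat (mat2 \<alpha> \<beta> \<beta> \<alpha>) ** symbol_power n"
proof -
  define A where "A = Polynomial.coeff D n"
  define a b c d where "a = A $ 1 $ 1" and "b = A $ 1 $ 2" and "c = A $ 2 $ 1" and "d = A $ 2 $ 2"
  note abcd = a_def b_def c_def d_def
  define ode where "ode = (\<lambda>(f::complex poly) y z. (1 - [:0,1:]\<^sup>2) * pderiv f =
      (Polynomial.smult z (1 - [:0,1:]) - Polynomial.smult y (1 + [:0,1:])) * f)"
  have ode_iff: "ode f y z \<longleftrightarrow> (\<forall>x. (1 - x\<^sup>2) * poly (pderiv f) x = (z * (1 - x) - y * (1 + x)) * poly f x)" for f y z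
  proof
    show "\<forall>x. (1 - x\<^sup>2) * poly (pderiv f) x = (z * (1 - x) - y * (1 + x)) * poly f x" if "ode f y z"
    proof
      fix x
      show "(1 - x\<^sup>2) * poly (pderiv f) x = (z * (1 - x) - y * (1 + x)) * poly f x"
        using arg_cong[OF that[unfolded ode_def], of "\<lambda>p. poly p x"] by simp
    qed
    show "ode f y z" if "\<forall>x. (1 - x\<^sup>2) * poly (pderiv f) x = (z * (1 - x) - y * (1 + x)) * poly f x"
      unfolding ode_def by (rule poly_ext) (use that in simp)
  qed
  note eq = leading_coeff_equation[OF deg comm[unfolded jacobi_op_def], folded A_def]
  have eqx: "poly (2 * [:-1,0,1:] * pderiv (A $ i $ j) + (mat2 [:2 * h, 2 * r + 1:] (-1) (-1) [:2 * h, 2 * r + 1:] ** A) $ i $ j) x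
     = poly ((A ** mat2 [:2 * h, 2 * r + 1:] (-1) (-1) [:2 * h, 2 * r + 1:]) $ i $ j + of_nat n * pderiv [:-1,0,1:] * A $ i $ j) x" for i j x
    by (simp only: eq)
  note odes = odes_of_entries[where t = "2 * h + x * (2 * r + 1)" and x = x and n = "of_nat n"
    and a = "poly a x" and b = "poly b x" and c = "poly c x" and d = "poly d x"
    and a' = "poly (pderiv a) x" and b' = "poly (pderiv b) x"
    and c' = "poly (pderiv c) x" and d' = "poly (pderiv d) x" for x]
  have hyps: "2 * (x\<^sup>2 - 1) * poly (pderiv a) x + ((2 * h + x * (2 * r + 1)) * poly a x - poly c x)
        = (poly a x * (2 * h + x * (2 * r + 1)) - poly b x) + of_nat n * (2 * x) * poly a x"
      "2 * (x\<^sup>2 - 1) * poly (pderiv b) x + ((2 * h + x * (2 * r + 1)) * poly b x - poly d x)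
        = (poly b x * (2 * h + x * (2 * r + 1)) - poly a x) + of_nat n * (2 * x) * poly b x"
      "2 * (x\<^sup>2 - 1) * poly (pderiv c) x + ((2 * h + x * (2 * r + 1)) * poly c x - poly a x)
        = (poly c x * (2 * h + x * (2 * r + 1)) - poly d x) + of_nat n * (2 * x) * poly c x"
      "2 * (x\<^sup>2 - 1) * poly (pderiv d) x + ((2 * h + x * (2 * r + 1)) * poly d x - poly b x)
        = (poly d x * (2 * h + x * (2 * r + 1)) - poly c x) + of_nat n * (2 * x) * poly d x" for x
    using eqx[of 1 1 x] eqx[of 1 2 x] eqx[of 2 1 x] eqx[of 2 2 x]
    by (simp_all add: mat2_entries abcd pderiv_pCons power2_eq_square algebra_simps of_nat_poly)
  have u: "ode (a + d) (of_nat n / 2) (of_nat n / 2)"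
    and v: "ode (b + c) (of_nat n / 2) (of_nat n / 2)"
    and f: "ode (a - d + (b - c)) ((of_nat n - 1) / 2) ((of_nat n + 1) / 2)"
    and g: "ode (a - d - (b - c)) ((of_nat n + 1) / 2) ((of_nat n - 1) / 2)"
    using odes[OF hyps] by (simp_all add: ode_iff pderiv_add pderiv_diff)
  have base: "[:-1,1:] ^ m * [:1,1:] ^ m = ([:-1,0,1:] ^ m :: complex poly)" for m
  proof -
    have "[:-1,1:] * [:1,1:] = ([:-1,0,1:] :: complex poly)" by simp
    then show ?thesis by (metis power_mult_distrib)
  qed
  have solve: "\<exists>s t z. y = of_nat s \<and> y' = of_nat t \<and> f = Polynomial.smult z ([:-1,1:] ^ s * [:1,1:] ^ t)"
    if "ode f y y'" "f \<noteq> 0" for f y y'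
    using first_order_ode_polynomial[of f y' y] that unfolding ode_def by blast
  have cancel: "p = Polynomial.smult (z / 2) q" if "p + p = Polynomial.smult z q" for p q :: "complex poly" and z
  proof (rule poly_ext)
    fix x
    show "poly p x = poly (Polynomial.smult (z / 2) q) x"
      using arg_cong[OF that, of "\<lambda>p. poly p x"] by (simp add: field_simps)
  qed
  let ?s = "[:-1,0,1:] :: complex poly"
  show ?thesis
  proof (cases "even n")
    case True
    then obtain m where m: "n = 2 * m" by blast
    \<comment> \<open>An exponent \<open>(n + 1)/2\<close> with even \<open>n\<close> is not a natural number.\<close>
    have no: "p = 0" if "ode p ((of_nat n - 1) / 2) ((of_nat n + 1) / 2) \<or> ode p ((of_nat n + 1) / 2) ((of_nat n - 1) / 2)" for p
    proof (rule ccontr)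
      assume "p \<noteq> 0"
      with that solve have "\<exists>t. (of_nat n + 1) / 2 = (of_nat t :: complex)" by blast
      then obtain t where "of_nat (n + 1) = (of_nat (2 * t) :: complex)" by (auto simp: field_simps)
      then have "n + 1 = 2 * t" by (simp only: of_nat_eq_iff)
      with m show False by presburger
    qed
    have yes: "\<exists>z. p = Polynomial.smult z (?s ^ m)" if "ode p (of_nat n / 2) (of_nat n / 2)" for p
    proof (cases "p = 0")
      case False
      with that solve obtain s t z where "of_nat n / 2 = (of_nat s :: complex)" "of_nat n / 2 = (of_nat t :: complex)"
        "p = Polynomial.smult z ([:-1,1:] ^ s * [:1,1:] ^ t)" by blast
      moreover from this have "s = m" "t = m" by (simp_all add: m)
      ultimately show ?thesis by (auto simp: base)
    qed (auto intro: exI[of _ 0])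
    from yes[OF u] yes[OF v] obtain y z where yz: "a + d = Polynomial.smult y (?s ^ m)" "b + c = Polynomial.smult z (?s ^ m)" by blast
    have fg: "a - d + (b - c) = 0" "a - d - (b - c) = 0" using no f g by blast+
    have "2 * (a - d) = (a - d + (b - c)) + (a - d - (b - c))"
      "2 * (b - c) = (a - d + (b - c)) - (a - d - (b - c))" by simp_all
    then have "2 * (a - d) = 0" "2 * (b - c) = 0" unfolding fg by simp_all
    then have "d = a" "c = b" by simp_all
    with yz cancel have "a = Polynomial.smult (y / 2) (?s ^ m)" "b = Polynomial.smult (z / 2) (?s ^ m)"
      by blast+
    then have "A = const_pmat (mat2 (y / 2) (z / 2) (z / 2) (y / 2)) ** symbol_power n"
      using \<open>d = a\<close> \<open>c = b\<close> unfolding m symbol_power_even by (simp add: mat2_entries const_pmat_def abcd)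
    then show ?thesis unfolding A_def by blast
  next
    case False
    then obtain m where m: "n = Suc (2 * m)" by (auto elim: oddE)
    \<comment> \<open>An exponent \<open>n/2\<close> with odd \<open>n\<close> is not a natural number.\<close>
    have no: "p = 0" if "ode p (of_nat n / 2) (of_nat n / 2)" for p
    proof (rule ccontr)
      assume "p \<noteq> 0"
      with that solve have "\<exists>t. of_nat n / 2 = (of_nat t :: complex)" by blast
      then obtain t where "of_nat n = (of_nat (2 * t) :: complex)" by (auto simp: field_simps)
      then have "n = 2 * t" by (simp only: of_nat_eq_iff)
      with m show False by presburger
    qed
    have idx: "t = i" if "of_nat i = (of_nat t :: complex)" for t i :: nat using that by simp
    have half: "(of_nat n - 1) / 2 = (of_nat m :: complex)" "(of_nat n + 1) / 2 = (of_nat (Suc m) :: complex)"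
      by (simp_all add: m field_simps)
    have f': "\<exists>z. a - d + (b - c) = Polynomial.smult z (?s ^ m * [:1,1:])"
    proof (cases "a - d + (b - c) = 0")
      case False
      with f[unfolded half] solve obtain s t z where "of_nat m = (of_nat s :: complex)" "of_nat (Suc m) = (of_nat t :: complex)"
        "a - d + (b - c) = Polynomial.smult z ([:-1,1:] ^ s * [:1,1:] ^ t)" by blast
      moreover from this have "s = m" "t = Suc m" using idx by blast+
      moreover have "[:-1,1:] ^ m * [:1,1:] ^ Suc m = ?s ^ m * [:1,1:]"
        by (simp only: base[symmetric] power_Suc ac_simps)
      ultimately show ?thesis by metis
    qed (auto intro: exI[of _ 0])
    have g': "\<exists>z. a - d - (b - c) = Polynomial.smult z (?s ^ m * [:-1,1:])"
    proof (cases "a - d - (b - c) = 0")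
      case False
      with g[unfolded half] solve obtain s t z where "of_nat (Suc m) = (of_nat s :: complex)" "of_nat m = (of_nat t :: complex)"
        "a - d - (b - c) = Polynomial.smult z ([:-1,1:] ^ s * [:1,1:] ^ t)" by blast
      moreover from this have "s = Suc m" "t = m" using idx by blast+
      moreover have "[:-1,1:] ^ Suc m * [:1,1:] ^ m = ?s ^ m * [:-1,1:]"
        by (simp only: base[symmetric] power_Suc ac_simps)
      ultimately show ?thesis by metis
    qed (auto intro: exI[of _ 0])
    from no[OF u] no[OF v] have dc: "d = - a" "c = - b" by (simp_all add: eq_neg_iff_add_eq_0 add.commute)
    from f' g' obtain y z where yz: "a - d + (b - c) = Polynomial.smult y (?s ^ m * [:1,1:])"
      "a - d - (b - c) = Polynomial.smult z (?s ^ m * [:-1,1:])" by blast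
    have yzx: "2 * poly a x + 2 * poly b x = y * (poly ?s x ^ m * (1 + x))"
      "2 * poly a x - 2 * poly b x = z * (poly ?s x ^ m * (x - 1))" for x
      using arg_cong[OF yz(1), of "\<lambda>p. poly p x"] arg_cong[OF yz(2), of "\<lambda>p. poly p x"]
      by (simp_all add: dc del: mult_pCons_right)
    \<comment> \<open>Obtained by comparing with the product of \<open>\<alpha> I + \<beta> S\<close> and \<open>\<ell>\<close>, whose first row is \<open>(\<beta> - \<alpha> x, \<beta> x - \<alpha>)\<close>.\<close>
    define \<alpha> \<beta> where "\<alpha> = - (y + z) / 4" and "\<beta> = (y - z) / 4"
    have "y = 2 * (\<beta> - \<alpha>)" "z = - (2 * (\<alpha> + \<beta>))" by (simp_all add: \<alpha>_def \<beta>_def field_simps)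
    note yzx = yzx[unfolded this]
    have ax: "poly a x = (\<beta> - \<alpha> * x) * poly ?s x ^ m" "poly b x = (\<beta> * x - \<alpha>) * poly ?s x ^ m" for x
    proof -
      define w where "w = poly ?s x ^ m"
      have "4 * poly a x = 4 * ((\<beta> - \<alpha> * x) * w)"
        using arg_cong2[OF yzx(1)[of x] yzx(2)[of x], of "(+)", folded w_def] by (simp add: algebra_simps)
      then show "poly a x = (\<beta> - \<alpha> * x) * poly ?s x ^ m" by (simp add: w_def)
      have "4 * poly b x = 4 * ((\<beta> * x - \<alpha>) * w)"
        using arg_cong2[OF yzx(1)[of x] yzx(2)[of x], of "(-)", folded w_def] by (simp add: algebra_simps)
      then show "poly b x = (\<beta> * x - \<alpha>) * poly ?s x ^ m" by (simp add: w_def)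
    qed
    have "A = const_pmat (mat2 \<alpha> \<beta> \<beta> \<alpha>) ** symbol_power n"
      unfolding m symbol_power_odd vec_eq_iff forall_2 abcd[symmetric]
      by (intro conjI poly_ext)
        (simp_all add: dc ax mat2_entries const_pmat_def symbol_base_def algebra_simps)
    then show ?thesis unfolding A_def by blast
  qed
qed

section \<open>Two-dimensional quotients\<close>

lemma weyl_smult_smult: "weyl_smult a (weyl_smult b D) = weyl_smult (a * b) D"
  by (simp add: weyl_smult_def poly_eq_iff coeff_map_poly smult_pmat_def vec_eq_iff)

lemma weyl_smult_add_left: "weyl_smult (a + b) D = weyl_smult a D + weyl_smult b D"
  by (simp add: weyl_smult_def poly_eq_iff coeff_map_poly smult_pmat_def vec_eq_iff smult_add_left)

lemma weyl_smult_add_right: "weyl_smult a (D + E) = weyl_smult a D + weyl_smult a E"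
  by (simp add: weyl_smult_def poly_eq_iff coeff_map_poly smult_pmat_def vec_eq_iff smult_add_right)

lemma weyl_smult_1: "weyl_smult 1 D = D"
  by (simp add: weyl_smult_def poly_eq_iff coeff_map_poly smult_pmat_def vec_eq_iff)

lemma weyl_smult_minus_1: "weyl_smult (- 1) D = - D"
  by (simp add: weyl_smult_def poly_eq_iff coeff_map_poly smult_pmat_def vec_eq_iff)

definition weyl_subspace :: "weyl2 set \<Rightarrow> bool" where
  "weyl_subspace U \<longleftrightarrow> 0 \<in> U \<and> (\<forall>D\<in>U. \<forall>E\<in>U. D + E \<in> U) \<and> (\<forall>c. \<forall>D\<in>U. weyl_smult c D \<in> U)"

lemma weyl_subspace_diff: "weyl_subspace U \<Longrightarrow> D \<in> U \<Longrightarrow> E \<in> U \<Longrightarrow> D - E \<in> U"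
  unfolding weyl_subspace_def diff_conv_add_uminus weyl_smult_minus_1[symmetric] by blast

lemma field_complex_field: "field complex_field"
proof -
  have "cring complex_field"
  proof (rule cringI)
    show "abelian_group complex_field"
    proof (rule abelian_groupI)
      show "\<And>x. x \<in> carrier complex_field \<Longrightarrow>
          \<exists>y\<in>carrier complex_field. y \<oplus>\<^bsub>complex_field\<^esub> x = \<zero>\<^bsub>complex_field\<^esub>"
        by (rule_tac x = "- x" in bexI) (auto simp: complex_field_def)
    qed (auto simp: complex_field_def)
    show "Group.comm_monoid complex_field"
      by (rule comm_monoidI) (auto simp: complex_field_def)
  qed (auto simp: complex_field_def algebra_simps)
  then show ?thesis
  proof (rule cring.cring_fieldI)
    have "x \<in> Units complex_field" if "x \<noteq> 0" for x :: complex
      using that unfolding Units_def complex_field_def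
      by (auto intro!: exI[of _ "inverse x"])
    moreover have "0 \<notin> Units complex_field" by (auto simp: Units_def complex_field_def)
    ultimately show "Units complex_field = carrier complex_field - {\<zero>\<^bsub>complex_field\<^esub>}"
      by (auto simp: complex_field_def)
  qed
qed

context
  fixes V :: "weyl2 set"
  assumes V: "weyl_subspace V"
begin

lemma coset_add: "(D +o V) + (E +o V) = (D + E) +o V"
proof -
  have "V + V = V"
  proof
    show "V + V \<subseteq> V" using V by (auto simp: set_plus_def weyl_subspace_def)
    show "V \<subseteq> V + V" using V by (force simp: set_plus_def weyl_subspace_def)
  qed
  then show ?thesis by (simp add: set_plus_rearrange)
qed

text \<open>
  For \<open>c \<noteq> 0\<close> scaling maps cosets to cosets. For \<open>c = 0\<close> the summand \<open>V\<close> restores the zero coset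
  from the single operator \<open>0\<close>.
\<close>

lemma coset_smult: "weyl_smult c ` (D +o V) + V = weyl_smult c D +o V"
proof (intro equalityI subsetI)
  fix X assume "X \<in> weyl_smult c ` (D +o V) + V"
  then obtain v w where vw: "v \<in> V" "w \<in> V" "X = weyl_smult c (D + v) + w"
    by (auto simp: set_plus_def elt_set_plus_def)
  then have "X = weyl_smult c D + (weyl_smult c v + w)" by (simp add: weyl_smult_add_right add.assoc)
  moreover have "weyl_smult c v + w \<in> V" using vw V by (auto simp: weyl_subspace_def)
  ultimately show "X \<in> weyl_smult c D +o V" by (auto simp: elt_set_plus_def)
next
  fix X assume "X \<in> weyl_smult c D +o V"
  then obtain w where "w \<in> V" "X = weyl_smult c (D + 0) + w" by (auto simp: elt_set_plus_def)
  moreover have "0 \<in> V" using V by (simp add: weyl_subspace_def)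
  ultimately show "X \<in> weyl_smult c ` (D +o V) + V"
    unfolding set_plus_def elt_set_plus_def by blast
qed

lemma coset_eq_iff: "D +o V = E +o V \<longleftrightarrow> D - E \<in> V"
proof
  assume "D +o V = E +o V"
  moreover have "D \<in> D +o V" using V by (force simp: elt_set_plus_def weyl_subspace_def)
  ultimately show "D - E \<in> V" by (auto simp: elt_set_plus_def)
next
  assume DE: "D - E \<in> V"
  have sub: "D +o V \<subseteq> E +o V" if "D - E \<in> V" for D E
  proof
    fix X assume "X \<in> D +o V"
    then obtain v where v: "v \<in> V" "X = E + ((D - E) + v)" by (auto simp: elt_set_plus_def)
    moreover have "(D - E) + v \<in> V" using v that V by (simp add: weyl_subspace_def)
    ultimately show "X \<in> E +o V" unfolding elt_set_plus_def by blast
  qed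
  have "E - D \<in> V"
    using weyl_subspace_diff[OF V _ DE, of 0] V by (simp add: weyl_subspace_def)
  with DE show "D +o V = E +o V" using sub by blast
qed

lemma coset_0: "0 +o V = V"
  by (simp add: elt_set_plus_def)

lemma coset_add_zero: "(D +o V) + V = D +o V"
  using coset_add[of D 0] by (simp add: coset_0)

lemma quotient_space_vectorspace:
  assumes U: "weyl_subspace U"
  shows "vectorspace complex_field (quotient_space U V)"
proof (rule vs_criteria)
  show "field complex_field" by (rule field_complex_field)
  let ?Q = "quotient_space U V"
  have c: "carrier ?Q = (\<lambda>D. D +o V) ` U" by (simp add: quotient_space_def)
  have ops: "\<zero>\<^bsub>?Q\<^esub> = 0 +o V" "\<And>X Y. X \<oplus>\<^bsub>?Q\<^esub> Y = X + Y" "\<And>a X. a \<odot>\<^bsub>?Q\<^esub> X = weyl_smult a ` X + V"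
    by (simp_all add: quotient_space_def coset_0)
  have mem: "0 \<in> U" "\<And>D E. D \<in> U \<Longrightarrow> E \<in> U \<Longrightarrow> D + E \<in> U" "\<And>a D. D \<in> U \<Longrightarrow> weyl_smult a D \<in> U"
    using U by (auto simp: weyl_subspace_def)
  note simps = ops coset_add coset_smult c
  show "\<zero>\<^bsub>?Q\<^esub> \<in> carrier ?Q" unfolding simps using mem by blast
  show "\<forall>v\<in>carrier ?Q. \<exists>neg_v\<in>carrier ?Q. v \<oplus>\<^bsub>?Q\<^esub> neg_v = \<zero>\<^bsub>?Q\<^esub>"
  proof
    fix v assume "v \<in> carrier ?Q"
    then obtain D where D: "D \<in> U" "v = D +o V" by (auto simp: c)
    show "\<exists>neg_v\<in>carrier ?Q. v \<oplus>\<^bsub>?Q\<^esub> neg_v = \<zero>\<^bsub>?Q\<^esub>"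
    proof
      show "v \<oplus>\<^bsub>?Q\<^esub> (weyl_smult (- 1) D +o V) = \<zero>\<^bsub>?Q\<^esub>"
        by (simp add: D ops(1,2) coset_add weyl_smult_minus_1)
      show "weyl_smult (- 1) D +o V \<in> carrier ?Q" using D mem by (auto simp: c)
    qed
  qed
  show "\<forall>v w. v \<in> carrier ?Q \<and> w \<in> carrier ?Q \<longrightarrow> v \<oplus>\<^bsub>?Q\<^esub> w \<in> carrier ?Q"
    "\<forall>a v. a \<in> carrier complex_field \<and> v \<in> carrier ?Q \<longrightarrow> a \<odot>\<^bsub>?Q\<^esub> v \<in> carrier ?Q"
    using mem by (auto simp: simps)
  show "\<forall>v w. v \<in> carrier ?Q \<and> w \<in> carrier ?Q \<longrightarrow> v \<oplus>\<^bsub>?Q\<^esub> w = w \<oplus>\<^bsub>?Q\<^esub> v"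
    "\<forall>v w x. v \<in> carrier ?Q \<and> w \<in> carrier ?Q \<and> x \<in> carrier ?Q \<longrightarrow>
      v \<oplus>\<^bsub>?Q\<^esub> w \<oplus>\<^bsub>?Q\<^esub> x = v \<oplus>\<^bsub>?Q\<^esub> (w \<oplus>\<^bsub>?Q\<^esub> x)"
    by (simp_all add: ops add_ac)
qed (clarsimp simp: quotient_space_def complex_field_def coset_add coset_add_zero coset_smult,
      (simp add: weyl_smult_smult weyl_smult_1 weyl_smult_add_left weyl_smult_add_right)?)+

end

text \<open>
  The cosets of \<open>E1\<close> and \<open>E2\<close> are different by independence; every element of the quotient has
  unique coordinates with respect to them, hence they form a basis.
\<close>

lemma quotient_space_dim_2:
  assumes U: "weyl_subspace U" and V: "weyl_subspace V"
    and E: "E1 \<in> U" "E2 \<in> U"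
    and span: "\<And>D. D \<in> U \<Longrightarrow> \<exists>a b. D - (weyl_smult a E1 + weyl_smult b E2) \<in> V"
    and indep: "\<And>a b. weyl_smult a E1 + weyl_smult b E2 \<in> V \<Longrightarrow> a = 0 \<and> b = 0"
  shows "vectorspace complex_field (quotient_space U V) \<and>
    vectorspace.fin_dim complex_field (quotient_space U V) \<and>
    vectorspace.dim complex_field (quotient_space U V) = 2"
proof -
  let ?Q = "quotient_space U V"
  interpret vectorspace complex_field ?Q by (rule quotient_space_vectorspace[OF V U])
  let ?e1 = "E1 +o V" and ?e2 = "E2 +o V"
  have neq: "?e1 \<noteq> ?e2"
  proof
    assume "?e1 = ?e2"
    then have "weyl_smult 1 E1 + weyl_smult (- 1) E2 \<in> V"
      by (simp add: coset_eq_iff[OF V] weyl_smult_1 weyl_smult_minus_1)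
    then show False using indep by force
  qed
  have sub: "{?e1, ?e2} \<subseteq> carrier ?Q" using E by (auto simp: quotient_space_def)
  have lin: "lincomb a {?e1, ?e2} = (weyl_smult (a ?e1) E1 + weyl_smult (a ?e2) E2) +o V" for a
  proof -
    have "lincomb a {?e1, ?e2} = a ?e1 \<odot>\<^bsub>?Q\<^esub> ?e1 \<oplus>\<^bsub>?Q\<^esub> a ?e2 \<odot>\<^bsub>?Q\<^esub> ?e2"
      unfolding lincomb_def using neq sub
      by (subst finsum_insert) (auto simp: complex_field_def)
    then show ?thesis
      by (simp add: quotient_space_def coset_smult[OF V] coset_add[OF V])
  qed
  have "basis {?e1, ?e2}"
  proof (subst basis_criterion)
    show "\<forall>v. v \<in> carrier ?Q \<longrightarrow>
      (\<exists>!a. a \<in> {?e1, ?e2} \<rightarrow>\<^sub>E carrier complex_field \<and> lincomb a {?e1, ?e2} = v)"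
    proof (intro allI impI)
      fix v assume "v \<in> carrier ?Q"
      then obtain D where D: "D \<in> U" "v = D +o V" by (auto simp: quotient_space_def)
      from span[OF D(1)] obtain x y where xy: "D - (weyl_smult x E1 + weyl_smult y E2) \<in> V" by blast
      define a where "a = (\<lambda>e\<in>{?e1, ?e2}. if e = ?e1 then x else y)"
      show "\<exists>!a. a \<in> {?e1, ?e2} \<rightarrow>\<^sub>E carrier complex_field \<and> lincomb a {?e1, ?e2} = v"
      proof (rule ex1I[of _ a], rule conjI)
        show "a \<in> {?e1, ?e2} \<rightarrow>\<^sub>E carrier complex_field" by (auto simp: a_def complex_field_def)
        have "a ?e1 = x" "a ?e2 = y" using neq by (auto simp: a_def)
        then show a: "lincomb a {?e1, ?e2} = v"
          using xy by (simp add: lin D coset_eq_iff[OF V, symmetric])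
        fix b assume b: "b \<in> {?e1, ?e2} \<rightarrow>\<^sub>E carrier complex_field \<and> lincomb b {?e1, ?e2} = v"
        then have "(weyl_smult (b ?e1) E1 + weyl_smult (b ?e2) E2)
            - (weyl_smult (a ?e1) E1 + weyl_smult (a ?e2) E2) \<in> V"
          using a by (simp add: lin flip: coset_eq_iff[OF V])
        moreover have "weyl_smult (c - d) E = weyl_smult c E - weyl_smult d E" for c d E
          using weyl_smult_add_left[of "c - d" d E] by simp
        ultimately have "weyl_smult (b ?e1 - a ?e1) E1 + weyl_smult (b ?e2 - a ?e2) E2 \<in> V"
          by (simp only: add_diff_add)
        from indep[OF this] have "b ?e1 = a ?e1" "b ?e2 = a ?e2" by simp_all
        then show "b = a"
          using b by (intro PiE_ext[of b "{?e1, ?e2}" "\<lambda>_. carrier complex_field"])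
            (auto simp: a_def complex_field_def neq[symmetric])
      qed
    qed
  qed (use sub in auto)
  then have "dim = card {?e1, ?e2}" "gen_set {?e1, ?e2}"
    by (auto intro: dim_basis simp: basis_def)
  moreover from this have "fin_dim" unfolding fin_dim_def using sub by (intro exI[of _ "{?e1, ?e2}"]) auto
  ultimately show ?thesis using neq vectorspace_axioms by simp
qed

section \<open>Powers of the generator and reduction of the order\<close>

definition D_power :: "real \<Rightarrow> real \<Rightarrow> nat \<Rightarrow> weyl2" where
  "D_power k1 k2 n = (weyl_mult (D_op k1 k2) ^^ n) (const_op (mat 1))"

lemma coeff_D_power:
  "m > n \<Longrightarrow> Polynomial.coeff (D_power k1 k2 n) m = 0"
  "Polynomial.coeff (D_power k1 k2 n) n = symbol_power n"
proof (induction n arbitrary: m)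
  case 0
  { case 1 then show ?case by (simp add: D_power_def const_op_def coeff_pCons split: nat.splits)
  next case 2 show ?case by (simp add: D_power_def const_op_def symbol_power_def mat_def const_pmat_def mat2_entries) }
next
  case (Suc n)
  have "Polynomial.coeff (D_op k1 k2) 1 = symbol_base" "Polynomial.degree (D_op k1 k2) \<le> 1"
    by (simp_all add: D_op_def symbol_base_def)
  then have step: "Polynomial.coeff (D_power k1 k2 (Suc n)) m =
      Polynomial.coeff (D_op k1 k2) 0 ** Polynomial.coeff (D_power k1 k2 n) m
      + symbol_base ** (Polynomial.coeff (pCons 0 (D_power k1 k2 n)) m
          + pderiv_pmat (Polynomial.coeff (D_power k1 k2 n) m))" for m
    by (simp add: D_power_def coeff_weyl_mult coeff_partial_mult)
  { case 1 then show ?case using Suc(1)[of m] Suc(1)[of "m - 1"]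
      by (cases m) (simp_all add: step pmat2_mult_zero_add pderiv_pmat_0)
  next case 2 then show ?case using Suc(1)[of "Suc n"] Suc(2)
      by (simp add: step pmat2_mult_zero_add pderiv_pmat_0 symbol_power_def) }
qed

lemma coeff_S_op_mult:
  "Polynomial.coeff (weyl_mult S_op E) m = const_pmat (mat2 0 1 1 0) ** Polynomial.coeff E m"
  by (simp add: S_op_def const_op_def coeff_weyl_mult[where n = 0])

lemma coeff_weyl_smult: "Polynomial.coeff (weyl_smult c D) m = const_pmat (scalar_mat2 c) ** Polynomial.coeff D m"
  by (simp add: weyl_smult_eq coeff_map_poly pmat2_mult_zero_add)

text \<open>
  The operators \<open>(\<alpha> I + \<beta> S) \<D>\<^sub>k\<^sup>n\<close>. Their leading coefficients are exactly those that
  \<open>commuting_leading_coeff\<close> permits.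
\<close>

definition leading_family :: "real \<Rightarrow> real \<Rightarrow> nat \<Rightarrow> complex \<Rightarrow> complex \<Rightarrow> weyl2" where
  "leading_family k1 k2 n \<alpha> \<beta> =
     weyl_smult \<alpha> (D_power k1 k2 n) + weyl_smult \<beta> (weyl_mult S_op (D_power k1 k2 n))"

lemma coeff_leading_family:
  "m > n \<Longrightarrow> Polynomial.coeff (leading_family k1 k2 n \<alpha> \<beta>) m = 0"
  "Polynomial.coeff (leading_family k1 k2 n \<alpha> \<beta>) n = const_pmat (mat2 \<alpha> \<beta> \<beta> \<alpha>) ** symbol_power n"
proof -
  show "Polynomial.coeff (leading_family k1 k2 n \<alpha> \<beta>) m = 0" if "m > n"
    using that by (simp add: leading_family_def coeff_weyl_smult coeff_S_op_mult coeff_D_power pmat2_mult_zero_add)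
  have "const_pmat (scalar_mat2 \<alpha>) ** P + const_pmat (scalar_mat2 \<beta>) ** (const_pmat (mat2 0 1 1 0) ** P)
      = const_pmat (mat2 \<alpha> \<beta> \<beta> \<alpha>) ** P" for P
    by (simp add: scalar_mat2_def mat2_entries const_pmat_def)
  then show "Polynomial.coeff (leading_family k1 k2 n \<alpha> \<beta>) n = const_pmat (mat2 \<alpha> \<beta> \<beta> \<alpha>) ** symbol_power n"
    by (simp add: leading_family_def coeff_weyl_smult coeff_S_op_mult coeff_D_power)
qed

lemma weyl_subalgebra_subspace: "weyl_subalgebra A \<Longrightarrow> weyl_subspace A"
  by (auto simp: weyl_subalgebra_def weyl_subspace_def)

lemma D_power_in_subalgebra:
  assumes "weyl_subalgebra A" and "const_op (mat 1) \<in> A" and "S_op \<in> A" and "D_op k1 k2 \<in> A"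
  shows "D_power k1 k2 n \<in> A" and "weyl_mult S_op (D_power k1 k2 n) \<in> A"
    and "leading_family k1 k2 n \<alpha> \<beta> \<in> A"
proof -
  show *: "D_power k1 k2 n \<in> A"
    using assms by (induction n) (simp_all add: D_power_def weyl_subalgebra_def)
  with assms show "weyl_mult S_op (D_power k1 k2 n) \<in> A" "leading_family k1 k2 n \<alpha> \<beta> \<in> A"
    by (simp_all add: leading_family_def weyl_subalgebra_def)
qed

lemma generated_subalgebra_properties:
  shows "weyl_subalgebra (generated_subalgebra X)" and "X \<subseteq> generated_subalgebra X"
    and "weyl_subalgebra A \<Longrightarrow> X \<subseteq> A \<Longrightarrow> generated_subalgebra X \<subseteq> A"
proof -
  show "weyl_subalgebra (generated_subalgebra X)"
    unfolding generated_subalgebra_def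
    by (rule hull_in) (simp add: weyl_subalgebra_def)
qed (simp_all add: generated_subalgebra_def hull_subset hull_minimal)

lemma diff_op_algebra_upto_eq:
  "diff_op_algebra_upto W (int n - 1) = {D \<in> diff_op_algebra W. \<forall>m\<ge>n. Polynomial.coeff D m = 0}"
proof -
  have "D = 0 \<or> int (Polynomial.degree D) \<le> int n - 1 \<longleftrightarrow> (\<forall>m\<ge>n. Polynomial.coeff D m = 0)" for D :: weyl2
  proof
    assume *: "\<forall>m\<ge>n. Polynomial.coeff D m = 0"
    show "D = 0 \<or> int (Polynomial.degree D) \<le> int n - 1"
    proof (cases "D = 0")
      case False
      then have "\<not> n \<le> Polynomial.degree D" using * leading_coeff_0_iff by blast
      then show ?thesis by simp
    qed simp
  qed (auto simp: coeff_eq_0)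
  then show ?thesis by (auto simp: diff_op_algebra_upto_def)
qed

lemma weyl_subspace_order_less:
  "weyl_subspace {D \<in> diff_op_algebra W. \<forall>m\<ge>n. Polynomial.coeff D m = 0}"
  using diff_op_algebra_subalgebra[of W]
  by (auto simp: weyl_subspace_def weyl_subalgebra_def coeff_weyl_smult pmat2_mult_zero_add)

context
  fixes k1 k2 :: real
  assumes k1: "k1 \<ge> 0" and k2: "k2 \<ge> 0"
begin

lemma D_op_in_diff_op_algebra: "D_op k1 k2 \<in> diff_op_algebra (weight k1 k2)"
proof -
  have "const_op (mat2 (1/2) (of_real (k1 / 2)) (of_real (k1 / 2)) (1/2)) =
      weyl_smult (1/2) (const_op (mat 1)) + weyl_smult (of_real (k1 / 2)) S_op"
    by (simp add: weyl_smult_def const_op_def S_op_def map_poly_pCons smult_pmat_def const_pmat_def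
        mat_def mat2_entries)
  note split = this
  have closed: "\<And>D E. D \<in> diff_op_algebra W \<Longrightarrow> E \<in> diff_op_algebra W \<Longrightarrow> D + E \<in> diff_op_algebra W"
    "\<And>c D. D \<in> diff_op_algebra W \<Longrightarrow> weyl_smult c D \<in> diff_op_algebra W" for W
    using diff_op_algebra_subalgebra[of W] by (simp_all add: weyl_subalgebra_def)
  show ?thesis
    unfolding D_op_eq_shifted_op split
    by (intro closed shifted_op_in_diff_op_algebra[OF k1 k2] S_op_in_diff_op_algebra[OF k1 k2]
        const_op_1_in_diff_op_algebra)
qed

text \<open>
  On the eigenfamily both products send \<open>Q\<^sub>n\<close> to \<open>Q\<^sub>n \<Lambda> \<mu>\<^sub>n\<close>, because the scalar \<open>\<mu>\<^sub>n\<close> commutes with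
  \<open>\<Lambda>\<close>. The family generates all matrix polynomials under right multiplication by constant
  matrices. One orthogonal family suffices, since membership in the algebra speaks of all of them.
\<close>

lemma diff_op_algebra_commutes:
  assumes D: "D \<in> diff_op_algebra (weight k1 k2)"
  defines "J \<equiv> jacobi_op (of_real (rho k1 k2 + 1 / 2)) (of_real (k1 / 2))"
  shows "weyl_mult D J = weyl_mult J D"
proof (rule weyl_op_eqI)
  fix P
  obtain Q where Q: "matrix_orthogonal_polynomials (weight k1 k2) Q"
    and eig: "\<And>n. weyl_apply (jacobi_op (of_real (rho k1 k2 + 1 / 2)) (of_real (k1 / 2))) (Q n) =
      Q n ** const_pmat (scalar_mat2 ((of_nat n + of_real (rho k1 k2 + 1 / 2))\<^sup>2 - (of_real (k1 / 2))\<^sup>2))"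
    using orthogonal_eigenfamily[OF k1 k2] by blast
  define \<mu> where "\<mu> = (\<lambda>n::nat. (of_nat n + complex_of_real (rho k1 k2 + 1 / 2))\<^sup>2 - (of_real (k1 / 2))\<^sup>2)"
  have eigen: "weyl_apply J (Q n) = Q n ** const_pmat (scalar_mat2 (\<mu> n))" for n
    unfolding J_def \<mu>_def by (rule eig)
  define comm where "comm = (\<lambda>P. weyl_apply D (weyl_apply J P) = weyl_apply J (weyl_apply D P))"
  have "comm P" if "degree_less P n" for P n
    using that
  proof (induction n arbitrary: P)
    case 0
    then show ?case by (simp add: comm_def degree_less_0 weyl_apply_0_right)
  next
    case (Suc n)
    from Q Suc.prems obtain C where C: "degree_less (P - Q n ** const_pmat C) n"
      unfolding matrix_orthogonal_polynomials_iff[OF k1 k2] by (metis degree_less_split)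
    from D Q obtain \<Lambda> where \<Lambda>: "weyl_apply D (Q n) = Q n ** const_pmat \<Lambda>"
      unfolding diff_op_algebra_def by blast
    have "comm (Q n ** const_pmat C)"
      by (simp add: comm_def weyl_apply_mult_const eigen \<Lambda> scalar_mat2_commute
          flip: matrix_mul_assoc const_pmat_mult)
    moreover have "comm (P - Q n ** const_pmat C)" using Suc.IH C by blast
    ultimately have "comm ((P - Q n ** const_pmat C) + Q n ** const_pmat C)"
      unfolding comm_def weyl_apply_add_right by simp
    then show ?case by simp
  qed
  then show "weyl_apply (weyl_mult D J) P = weyl_apply (weyl_mult J D) P"
    using exists_degree_less[of P] by (auto simp: comm_def weyl_apply_weyl_mult)
qed

lemma leading_family_in_diff_op_algebra: "leading_family k1 k2 n \<alpha> \<beta> \<in> diff_op_algebra (weight k1 k2)"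
  using D_power_in_subalgebra(3) diff_op_algebra_subalgebra D_op_in_diff_op_algebra
    S_op_in_diff_op_algebra[OF k1 k2] const_op_1_in_diff_op_algebra by blast

lemma order_reduction:
  assumes "D \<in> diff_op_algebra (weight k1 k2)" and "\<And>m. m > n \<Longrightarrow> Polynomial.coeff D m = 0"
  obtains \<alpha> \<beta> where "\<And>m. m \<ge> n \<Longrightarrow> Polynomial.coeff (D - leading_family k1 k2 n \<alpha> \<beta>) m = 0"
proof -
  have "Polynomial.degree D \<le> n" using assms(2) by (intro degree_le) auto
  then obtain \<alpha> \<beta> where "Polynomial.coeff D n = const_pmat (mat2 \<alpha> \<beta> \<beta> \<alpha>) ** symbol_power n"
    using commuting_leading_coeff diff_op_algebra_commutes[OF assms(1)] by blast
  then have "Polynomial.coeff (D - leading_family k1 k2 n \<alpha> \<beta>) m = 0" if "m \<ge> n" for m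
    using that assms(2) by (cases "m = n") (simp_all add: coeff_leading_family)
  with that show ?thesis .
qed

text \<open>
  Induction on the order: \<open>order_reduction\<close> removes the leading term by an element of both
  algebras.
\<close>

lemma diff_op_algebra_least:
  assumes A: "weyl_subalgebra A" "const_op (mat 1) \<in> A" "S_op \<in> A" "D_op k1 k2 \<in> A"
  shows "diff_op_algebra (weight k1 k2) \<subseteq> A"
proof -
  have "D \<in> A" if "D \<in> diff_op_algebra (weight k1 k2)" "\<And>m. m \<ge> n \<Longrightarrow> Polynomial.coeff D m = 0" for D n
    using that
  proof (induction n arbitrary: D)
    case 0
    then have "D = 0" by (simp add: poly_eq_iff)
    with A(1) show ?case by (simp add: weyl_subalgebra_def)
  next
    case (Suc n)
    then obtain \<alpha> \<beta> where *: "\<And>m. m \<ge> n \<Longrightarrow> Polynomial.coeff (D - leading_family k1 k2 n \<alpha> \<beta>) m = 0"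
      using order_reduction[of D n] by (metis Suc_leI)
    have "D - leading_family k1 k2 n \<alpha> \<beta> \<in> diff_op_algebra (weight k1 k2)"
      by (intro weyl_subspace_diff weyl_subalgebra_subspace diff_op_algebra_subalgebra
          leading_family_in_diff_op_algebra Suc.prems)
    then have "D - leading_family k1 k2 n \<alpha> \<beta> \<in> A" using * by (rule Suc.IH)
    moreover have "leading_family k1 k2 n \<alpha> \<beta> \<in> A" by (rule D_power_in_subalgebra(3)[OF A])
    ultimately have "(D - leading_family k1 k2 n \<alpha> \<beta>) + leading_family k1 k2 n \<alpha> \<beta> \<in> A"
      using A(1) unfolding weyl_subalgebra_def by blast
    then show ?case by simp
  qed
  moreover have "\<And>m. m \<ge> Suc (Polynomial.degree D) \<Longrightarrow> Polynomial.coeff D m = 0" for D :: weyl2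
    by (simp add: coeff_eq_0)
  ultimately show ?thesis by blast
qed

text \<open>
  \<open>order_reduction\<close> says that the classes of \<open>\<D>\<^sub>k\<^sup>n\<close> and \<open>S \<D>\<^sub>k\<^sup>n\<close> span the quotient. Their independence
  is visible in the leading coefficients, where \<open>\<ell>\<^sup>n\<close> can be cancelled.
\<close>

lemma graded_piece_dim_2:
  defines "Q \<equiv> \<lambda>n. quotient_space (diff_op_algebra_upto (weight k1 k2) (int n))
                                 (diff_op_algebra_upto (weight k1 k2) (int n - 1))"
  shows "vectorspace complex_field (Q n) \<and> vectorspace.fin_dim complex_field (Q n) \<and>
    vectorspace.dim complex_field (Q n) = 2"
proof -
  define U V where "U = {D \<in> diff_op_algebra (weight k1 k2). \<forall>m\<ge>Suc n. Polynomial.coeff D m = 0}"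
    and "V = {D \<in> diff_op_algebra (weight k1 k2). \<forall>m\<ge>n. Polynomial.coeff D m = 0}"
  have Q: "Q n = quotient_space U V"
    using diff_op_algebra_upto_eq[of "weight k1 k2" "Suc n"] diff_op_algebra_upto_eq[of "weight k1 k2" n]
    by (simp add: Q_def U_def V_def)
  have gens: "D_power k1 k2 n \<in> diff_op_algebra (weight k1 k2)"
    "weyl_mult S_op (D_power k1 k2 n) \<in> diff_op_algebra (weight k1 k2)"
    using D_power_in_subalgebra(1,2) diff_op_algebra_subalgebra D_op_in_diff_op_algebra
      S_op_in_diff_op_algebra[OF k1 k2] const_op_1_in_diff_op_algebra by blast+
  show ?thesis
    unfolding Q
  proof (rule quotient_space_dim_2[where ?E1.0 = "D_power k1 k2 n" and ?E2.0 = "weyl_mult S_op (D_power k1 k2 n)",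
        folded leading_family_def])
    show "weyl_subspace U" "weyl_subspace V" unfolding U_def V_def by (rule weyl_subspace_order_less)+
    show "D_power k1 k2 n \<in> U" "weyl_mult S_op (D_power k1 k2 n) \<in> U"
      using gens by (simp_all add: U_def coeff_S_op_mult coeff_D_power pmat2_mult_zero_add)
    show "\<exists>a b. D - leading_family k1 k2 n a b \<in> V" if "D \<in> U" for D
    proof -
      from that have D: "D \<in> diff_op_algebra (weight k1 k2)" "\<And>m. m > n \<Longrightarrow> Polynomial.coeff D m = 0"
        by (auto simp: U_def)
      obtain a b where "\<And>m. m \<ge> n \<Longrightarrow> Polynomial.coeff (D - leading_family k1 k2 n a b) m = 0"
        using order_reduction[OF D] by blast
      moreover have "D - leading_family k1 k2 n a b \<in> diff_op_algebra (weight k1 k2)"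
        by (intro weyl_subspace_diff weyl_subalgebra_subspace diff_op_algebra_subalgebra
            leading_family_in_diff_op_algebra D)
      ultimately show ?thesis unfolding V_def by blast
    qed
    show "a = 0 \<and> b = 0" if "leading_family k1 k2 n a b \<in> V" for a b
    proof -
      from that have "const_pmat (mat2 a b b a) ** symbol_power n = 0"
        using coeff_leading_family(2)[of k1 k2 n a b] by (simp add: V_def)
      then have "const_pmat (mat2 a b b a) = 0" by (rule symbol_power_cancel)
      then show ?thesis by (simp add: const_pmat_def mat2_entries)
    qed
  qed
qed

end

theorem corollary3p15:
  fixes k1 k2 :: real
  assumes "k1 \<ge> 0" and "k2 \<ge> 0"
  shows "diff_op_algebra (weight k1 k2) =
           generated_subalgebra {const_op (mat 1), S_op, D_op k1 k2} \<and>
         (\<forall>N::nat.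
            let Q = quotient_space (diff_op_algebra_upto (weight k1 k2) (int N))
                                   (diff_op_algebra_upto (weight k1 k2) (int N - 1))
            in vectorspace complex_field Q \<and> vectorspace.fin_dim complex_field Q \<and>
               vectorspace.dim complex_field Q = 2)"
proof
  let ?X = "{const_op (mat 1), S_op, D_op k1 k2}"
  show "diff_op_algebra (weight k1 k2) = generated_subalgebra ?X"
  proof
    show "diff_op_algebra (weight k1 k2) \<subseteq> generated_subalgebra ?X"
      using generated_subalgebra_properties(1,2)[of ?X]
      by (intro diff_op_algebra_least[OF assms]) auto
    show "generated_subalgebra ?X \<subseteq> diff_op_algebra (weight k1 k2)"
      using diff_op_algebra_subalgebra const_op_1_in_diff_op_algebra S_op_in_diff_op_algebra[OF assms]
        D_op_in_diff_op_algebra[OF assms]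
      by (intro generated_subalgebra_properties(3)) auto
  qed
  show "\<forall>N::nat. let Q = quotient_space (diff_op_algebra_upto (weight k1 k2) (int N))
                                   (diff_op_algebra_upto (weight k1 k2) (int N - 1))
            in vectorspace complex_field Q \<and> vectorspace.fin_dim complex_field Q \<and>
               vectorspace.dim complex_field Q = 2"
    using graded_piece_dim_2[OF assms] unfolding Let_def by blast
qed

end
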